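(* Let $G$ be a unicyclic graph of order $n$ with even girth $g$ and matching number $\beta$. If $\beta\ge\frac{3g}{2}$, then $$W(G)\ge W(G^*_{(n,g,\beta)})=n^2+\Big(\beta-\frac{3g}{2}-1+\big\lfloor\tfrac{g^2}{4}\big\rfloor\Big)n-\frac{g}{2}\big\lfloor\tfrac{g^2}{4}\big\rfloor+\frac{3g}{2}-3\beta+2,$$ with equality if and only if $G$ is isomorphic to $G^*_{(n,g,\beta)}$.
   Context: All graphs are finite, simple, undirected and connected. $d_G(u,v)$ is the distance in $G$ and $W(G)=\sum_{\{u,v\}\subseteq V(G)} d_G(u,v)$ is the Wiener index. A unicyclic graph is a connected graph with exactly one cycle; its girth is the length of that cycle. The matching number is the maximum size of a matching. For nonnegative integers $a,b$, $T^*_{a,b}$ is the rooted tree of order $2a+b+1$ obtained from the star $K_{1,a+b}$ with root its center by attaching one new pendant vertex to each of $a$ of its leaves. For even $g$, $G^*_{(n,g,\beta)}$ is obtained from a cycle $C_g=u_1u_2\cdots u_g$ and the tree $T^*_{\beta-\frac g2-1,\,n-2\beta+1}$ (of order $n-g$) by identifying $u_1$ with the root of the tree and then adding a new vertex $v$ and the pendant edge $u_2v$. *)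

theory Defs
  imports Complex_Main "Graph_Theory.Graph_Theory"
begin

text \<open>
  A finite simple undirected graph is a \<^locale>\<open>pair_graph\<close>, in which every edge \<open>uv\<close> is
  represented by the two arcs \<open>(u, v)\<close> and \<open>(v, u)\<close>.
\<close>

definition edges :: "'a pair_pre_digraph \<Rightarrow> 'a set set" where
  "edges G = {{u, v} | u v. (u, v) \<in> parcs G}"

definition graph_dist :: "'a pair_pre_digraph \<Rightarrow> 'a \<Rightarrow> 'a \<Rightarrow> nat" where
  "graph_dist G u v = (LEAST k. \<exists>p. pre_digraph.apath (with_proj G) u p v \<and> length p = k)"

text \<open>The sum ranges over unordered pairs of distinct vertices; the inner description is
  well defined because \<^const>\<open>graph_dist\<close> is symmetric on undirected graphs.\<close>

definition wiener :: "'a pair_pre_digraph \<Rightarrow> nat" where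
  "wiener G = (\<Sum>e | e \<subseteq> pverts G \<and> card e = 2.
     THE d. \<exists>u v. e = {u, v} \<and> d = graph_dist G u v)"

text \<open>An undirected cycle is identified with its edge set. The length bound is needed because
  \<^const>\<open>pre_digraph.cycle\<close> also admits the closed walk that runs through a single edge back
  and forth; it also makes the length of the walk equal to the number of undirected edges.\<close>

definition cycle_edge_sets :: "'a pair_pre_digraph \<Rightarrow> 'a set set set" where
  "cycle_edge_sets G =
     {(\<lambda>(u, v). {u, v}) ` set p | p. pre_digraph.cycle (with_proj G) p \<and> 3 \<le> length p}"

definition unicyclic :: "'a pair_pre_digraph \<Rightarrow> bool" where
  "unicyclic G \<longleftrightarrow> pair_graph G \<and> connected (with_proj G) \<and> (\<exists>!C. C \<in> cycle_edge_sets G)"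

definition unicyclic_girth :: "'a pair_pre_digraph \<Rightarrow> nat" where
  "unicyclic_girth G = card (THE C. C \<in> cycle_edge_sets G)"

definition matching :: "'a pair_pre_digraph \<Rightarrow> 'a set set \<Rightarrow> bool" where
  "matching G M \<longleftrightarrow> M \<subseteq> edges G \<and> (\<forall>e\<in>M. \<forall>f\<in>M. e \<noteq> f \<longrightarrow> e \<inter> f = {})"

definition matching_number :: "'a pair_pre_digraph \<Rightarrow> nat" where
  "matching_number G = Max (card ` {M. matching G M})"

datatype tree_vertex = Root | Leaf nat | Pend nat

definition T_star :: "nat \<Rightarrow> nat \<Rightarrow> tree_vertex pair_pre_digraph" where
  "T_star a b = \<lparr>
     pverts = {Root} \<union> Leaf ` {1..a + b} \<union> Pend ` {1..a},
     parcs = symcl ({(Root, Leaf i) | i. i \<in> {1..a + b}} \<union> {(Leaf i, Pend i) | i. i \<in> {1..a}}) \<rparr>"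

text \<open>\<open>U i\<close> is the cycle vertex \<open>u\<^sub>i\<close>, \<open>Tr x\<close> a non-root vertex of the tree, and \<open>V\<close> the
  additional pendant vertex; \<open>embed_tree\<close> identifies the root of the tree with \<open>u\<^sub>1\<close>.\<close>

datatype g_vertex = U nat | Tr tree_vertex | V

definition embed_tree :: "tree_vertex \<Rightarrow> g_vertex" where
  "embed_tree x = (if x = Root then U 1 else Tr x)"

text \<open>The subtractions on \<^typ>\<open>nat\<close> are exact when \<open>g / 2 + 1 \<le> \<beta>\<close> and \<open>2 * \<beta> \<le> n + 1\<close>,
  which is the only range in which the construction is used.\<close>

definition G_star :: "nat \<Rightarrow> nat \<Rightarrow> nat \<Rightarrow> g_vertex pair_pre_digraph" where
  "G_star n g \<beta> = (let T = T_star (\<beta> - g div 2 - 1) (n + 1 - 2 * \<beta>) in \<lparr>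
     pverts = U ` {1..g} \<union> embed_tree ` pverts T \<union> {V},
     parcs = symcl ({(U i, U (i + 1)) | i. i \<in> {1..<g}} \<union> {(U g, U 1)})
             \<union> map_prod embed_tree embed_tree ` parcs T
             \<union> symcl {(U 2, V)} \<rparr>)"

end

(*
  Let h = g/2, let e_i be the number of vertices hanging below the cycle vertex u_i and E their sum.
  A graph distance counts the separating bridges and the separating pairs of opposite cycle edges,
  so with k ranging over the sizes of the subtrees below the bridges and d over cycle distances

    W = sum k (n - k) + h^3 + h^2 E + sum_{i<j} e_i e_j d(u_i, u_j).

  A bridge to a pendant vertex contributes n - 1 and any other one at least 2 (n - 2); if q bridges
  are of the second kind and K of the e_i are positive, then the last sum is at least
  (K - 1)(2 E - K) / 2.  Giving weight 2 to every off-cycle vertex that is not pendant and to every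
  cycle vertex with e_i > 0, weight 1 to the other cycle vertices and weight 0 to the pendant
  vertices covers each edge at least twice, so 2 beta <= 2 q + 2 h + K.  Since n >= 2 beta >= 6 h,
  the resulting bound is smallest exactly for K = 2, q = beta - h - 1, and there it is attained only
  if all k are at most 2, the two loaded cycle vertices are adjacent and one of them carries a
  single pendant vertex.
*)
theory Submission
  imports Defs
begin

section \<open>Distances, Wiener index and isomorphisms\<close>

text \<open>Shortest paths are not analysed directly. Every vertex gets a code, the set of cuts that
  have it on a fixed side, and distance is the Hamming distance of codes; an even cycle admits such
  a code because its edges pair off with their opposites. Summing over cuts instead of vertex pairs
  then gives the formula. G and the extremal graph are both instances of one locale, so the same
  formula evaluates both.

  The minimisation faces a trade-off: in the matching bound, two more loaded cycle vertices replace
  one non-pendant vertex, which saves n - 3. Compared with K = 2, twice the index therefore grows by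
  at least (K - 2)(2 E - K - 1) - (K - 2)(n - 3) = (K - 2)(E - 2 h - K + 2) when K > 2. Since K may
  be as large as 2 h, this is where the assumption on beta acts: it yields E >= 4 h. For K = 1 the
  right side of the matching bound is odd, and rounding costs one more non-pendant vertex.\<close>

context pair_wf_digraph begin

lemma awalk_relpow: "awalk u p v \<Longrightarrow> (u, v) \<in> parcs G ^^ length p"
proof (induction p arbitrary: u)
  case (Cons a p)
  then show ?case
    by (cases a) (auto simp: awalk_Cons_iff simp del: relpow.simps intro: relpow_Suc_I2)
qed (simp add: awalk_Nil_iff)

lemma relpow_awalk:
  assumes "u \<in> pverts G" "(u, v) \<in> parcs G ^^ k"
  shows "\<exists>p. awalk u p v \<and> length p = k"
  using assms
proof (induction k arbitrary: u)
  case 0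
  then show ?case by (auto simp: awalk_Nil_iff)
next
  case (Suc k)
  from Suc.prems(2) obtain w where w: "(u, w) \<in> parcs G" "(w, v) \<in> parcs G ^^ k"
    by (rule relpow_Suc_E2)
  from Suc.IH[OF in_arcsD2[OF w(1)] w(2)] obtain p where "awalk w p v" "length p = k"
    by (elim exE conjE)
  then have "awalk u ((u, w) # p) v \<and> length ((u, w) # p) = Suc k"
    using w(1) by (simp add: awalk_Cons_iff)
  then show ?case by (rule exI)
qed

lemma relpow_iff_awalk:
  assumes "u \<in> pverts G"
  shows "(u, v) \<in> parcs G ^^ k \<longleftrightarrow> (\<exists>p. awalk u p v \<and> length p = k)"
proof
  assume "\<exists>p. awalk u p v \<and> length p = k"
  then show "(u, v) \<in> parcs G ^^ k" by (elim exE conjE) (use awalk_relpow in blast)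
qed (rule relpow_awalk[OF assms])

text \<open>A shortest walk repeats no vertex, so the restriction to paths in
  \<open>graph_dist\<close> is harmless and distances become exponents of a relation. If no walk
  exists, both sets of lengths are empty and both \<open>LEAST\<close> terms denote the same
  unspecified number.\<close>

lemma graph_dist_relpow:
  assumes u: "u \<in> pverts G"
  shows "graph_dist G u v = (LEAST k. (u, v) \<in> parcs G ^^ k)"
proof (cases "\<exists>p. awalk u p v")
  case False
  then have "(\<exists>p. apath u p v \<and> length p = k) \<longleftrightarrow> (u, v) \<in> parcs G ^^ k" for k
    using relpow_awalk[OF u] awalkI_apath by blast
  then have "(\<lambda>k. \<exists>p. apath u p v \<and> length p = k) = (\<lambda>k. (u, v) \<in> parcs G ^^ k)" by (rule ext)
  from graph_dist_def arg_cong[OF this, of Least] show ?thesis by (rule trans)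
next
  case True
  let ?m = "LEAST k. \<exists>p. awalk u p v \<and> length p = k"
  from True have "\<exists>p. awalk u p v \<and> length p = ?m"
    using LeastI_ex[of "\<lambda>k. \<exists>p. awalk u p v \<and> length p = k"] by blast
  then obtain p where p: "awalk u p v" "length p = ?m" by blast
  have "apath u p v"
  proof (rule ccontr)
    assume "\<not> ?thesis"
    with p have "\<not> distinct (awalk_verts u p)" by (simp add: apath_def)
    from awalk_not_distinct_decomp[OF p(1) this]
    obtain q r s w where d: "p = q @ r @ s" "0 < length r"
      "awalk u q w" "awalk w r w" "awalk w s v" by (elim exE conjE)
    have "awalk u (q @ s) v" by (rule awalk_appendI[OF d(3,5)])
    then have "?m \<le> length (q @ s)" by (blast intro: Least_le)
    with d(2) p(2) show False unfolding d(1) length_append by linarith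
  qed
  have "(LEAST k. \<exists>p. apath u p v \<and> length p = k) = ?m"
  proof (rule Least_equality)
    show "\<exists>p. apath u p v \<and> length p = ?m" using \<open>apath u p v\<close> p(2) by blast
  next
    fix y assume "\<exists>p. apath u p v \<and> length p = y"
    then obtain p' where "awalk u p' v \<and> length p' = y" unfolding apath_def by blast
    then show "?m \<le> y" by (intro Least_le exI)
  qed
  then show ?thesis
    unfolding graph_dist_def relpow_iff_awalk[OF u] .
qed

end

text \<open>Ordered pairs remove the \<open>THE\<close> and give two independent summations, which
  the cut formula can interchange. Grouping by the underlying set works because each fibre has two
  elements; symmetry makes the description unique.\<close>

lemma wiener_double_sum:
  assumes fin: "finite (pverts G)"
    and sym: "\<And>x y. x \<in> pverts G \<Longrightarrow> y \<in> pverts G \<Longrightarrow> graph_dist G x y = graph_dist G y x"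
    and zero: "\<And>x. x \<in> pverts G \<Longrightarrow> graph_dist G x x = 0"
  shows "2 * wiener G = (\<Sum>x\<in>pverts G. \<Sum>y\<in>pverts G. graph_dist G x y)"
proof -
  let ?S = "{(x, y). x \<in> pverts G \<and> y \<in> pverts G \<and> x \<noteq> y}"
  let ?T = "{e. e \<subseteq> pverts G \<and> card e = 2}"
  let ?g = "\<lambda>(x, y). {x, y}" and ?d = "\<lambda>(x, y). graph_dist G x y"
  have finS: "finite ?S" by (rule finite_subset[of _ "pverts G \<times> pverts G"]) (use fin in auto)
  have finT: "finite ?T" by (rule finite_subset[of _ "Pow (pverts G)"]) (use fin in auto)
  have "(\<Sum>x\<in>pverts G. \<Sum>y\<in>pverts G. graph_dist G x y) = sum ?d (pverts G \<times> pverts G)"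
    by (simp add: sum.cartesian_product)
  also have "\<dots> = sum ?d ?S"
    by (rule sum.mono_neutral_right) (use fin zero in auto)
  also have "\<dots> = (\<Sum>e\<in>?T. sum ?d {z \<in> ?S. ?g z = e})"
    by (rule sum.group[symmetric]) (use finS finT in auto)
  also have "\<dots> = (\<Sum>e\<in>?T. 2 * (THE d. \<exists>u v. e = {u, v} \<and> d = graph_dist G u v))"
  proof (rule sum.cong[OF refl])
    fix e assume "e \<in> ?T"
    then obtain a b where e: "e = {a, b}" "a \<noteq> b" "a \<in> pverts G" "b \<in> pverts G"
      by (auto simp: card_2_iff)
    have "{z \<in> ?S. ?g z = e} = {(a, b), (b, a)}"
      using e by (auto simp: doubleton_eq_iff)
    moreover have "(THE d. \<exists>u v. e = {u, v} \<and> d = graph_dist G u v) = graph_dist G a b"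
      using e sym by (intro the_equality) (auto simp: doubleton_eq_iff)
    ultimately show "sum ?d {z \<in> ?S. ?g z = e} = 2 * (THE d. \<exists>u v. e = {u, v} \<and> d = graph_dist G u v)"
      using e sym[of a b] by simp
  qed
  finally show ?thesis by (simp add: wiener_def sum_distrib_left)
qed

section \<open>Invariance of the Wiener index under isomorphism\<close>

lemma relpow_image:
  assumes "inj_on f X" "R \<subseteq> X \<times> X" "x \<in> X"
  shows "(f x, z) \<in> (map_prod f f ` R) ^^ k \<longleftrightarrow> (\<exists>y. z = f y \<and> (x, y) \<in> R ^^ k)"
proof
  show "\<exists>y. z = f y \<and> (x, y) \<in> R ^^ k" if "(f x, z) \<in> (map_prod f f ` R) ^^ k"
    using that
  proof (induction k arbitrary: z)
    case (Suc k)
    from Suc.prems obtain w where w: "(f x, w) \<in> (map_prod f f ` R) ^^ k" "(w, z) \<in> map_prod f f ` R"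
      by (rule relpow_Suc_E)
    from Suc.IH[OF w(1)] obtain y where y: "w = f y" "(x, y) \<in> R ^^ k" by blast
    from w(2) obtain a b where ab: "(a, b) \<in> R" "w = f a" "z = f b" by auto
    have "y \<in> X" using y(2) assms(2,3) by (cases k) auto
    then have "a = y" using assms(1,2) ab y(1) by (auto dest: inj_onD)
    then show ?case using ab y(2) by (auto intro: relpow_Suc_I)
  qed auto
  show "(f x, z) \<in> (map_prod f f ` R) ^^ k" if "\<exists>y. z = f y \<and> (x, y) \<in> R ^^ k"
    using that
  proof (induction k arbitrary: z)
    case (Suc k)
    then obtain y w where "z = f y" "(x, w) \<in> R ^^ k" "(w, y) \<in> R"
      by (auto elim: relpow_Suc_E)
    then show ?case
      using Suc.IH[of "f w"] by (intro relpow_Suc_I[of _ "f w"]) force+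
  qed auto
qed

text \<open>Tail and head are \<open>fst\<close> and \<open>snd\<close> on both sides, which forces
  the arc map of an isomorphism to be \<open>map_prod f f\<close>; only a vertex map remains to be
  constructed.\<close>

lemma digraph_iso_pair_iff:
  fixes G :: "'a pair_pre_digraph" and H :: "'b pair_pre_digraph"
  assumes "pair_wf_digraph G"
  shows "digraph_iso (with_proj G) (with_proj H) \<longleftrightarrow>
    (\<exists>f. inj_on f (pverts G) \<and> pverts H = f ` pverts G \<and> parcs H = map_prod f f ` parcs G)"
    (is "?L \<longleftrightarrow> ?R")
proof
  interpret pair_wf_digraph G by fact
  assume ?L
  then obtain i where i: "digraph_isomorphism i" "with_proj H = app_iso i (with_proj G)"
    by (auto simp: digraph_iso_def)
  have *: "pverts H = iso_verts i ` pverts G" "parcs H = iso_arcs i ` parcs G"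
    "iso_tail i = fst" "iso_head i = snd"
    using arg_cong[OF i(2), of verts] arg_cong[OF i(2), of arcs]
      arg_cong[OF i(2), of tail] arg_cong[OF i(2), of head] by simp_all
  have "iso_arcs i a = map_prod (iso_verts i) (iso_verts i) a" if "a \<in> parcs G" for a
    using i(1) that *(3,4) by (cases a, cases "iso_arcs i a") (auto simp: digraph_isomorphism_def)
  then have "parcs H = map_prod (iso_verts i) (iso_verts i) ` parcs G"
    using *(2) by (metis image_cong)
  with * show ?R using digraph_isomorphism_inj_on_verts[OF i(1)]
    by (intro exI[of _ "iso_verts i"]) auto
next
  interpret pair_wf_digraph G by fact
  assume ?R
  then obtain f where f: "inj_on f (pverts G)" "pverts H = f ` pverts G"
    "parcs H = map_prod f f ` parcs G" by blast
  let ?i = "\<lparr>iso_verts = f, iso_arcs = map_prod f f, iso_head = snd, iso_tail = fst\<rparr>"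
  have "wf_digraph (with_proj G)" by unfold_locales
  moreover have "inj_on (map_prod f f) (parcs G)"
  proof (rule inj_onI)
    fix a b assume ab: "a \<in> parcs G" "b \<in> parcs G" "map_prod f f a = map_prod f f b"
    then have "f (fst a) = f (fst b)" "f (snd a) = f (snd b)"
      by (simp_all add: map_prod_def split_beta)
    then show "a = b"
      using ab inj_onD[OF f(1)] arc_fst_in_verts arc_snd_in_verts by (simp add: prod_eq_iff)
  qed
  ultimately have "digraph_isomorphism ?i"
    using f(1) by (auto simp: digraph_isomorphism_def)
  moreover have "with_proj H = app_iso ?i (with_proj G)"
    using f by (simp add: app_iso_def with_proj_def)
  ultimately show ?L unfolding digraph_iso_def by blast
qed

lemma graph_dist_image:
  assumes G: "pair_wf_digraph G" and H: "pair_wf_digraph H"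
    and f: "inj_on f (pverts G)" "pverts H = f ` pverts G" "parcs H = map_prod f f ` parcs G"
    and xy: "x \<in> pverts G" "y \<in> pverts G"
  shows "graph_dist H (f x) (f y) = graph_dist G x y"
proof -
  interpret G: pair_wf_digraph G by fact
  interpret H: pair_wf_digraph H by fact
  have sub: "parcs G \<subseteq> pverts G \<times> pverts G"
    using G.wellformed' by (intro subsetI) (metis SigmaI surj_pair)
  have "(\<exists>z. f y = f z \<and> (x, z) \<in> parcs G ^^ k) \<longleftrightarrow> (x, y) \<in> parcs G ^^ k" for k
  proof
    assume "\<exists>z. f y = f z \<and> (x, z) \<in> parcs G ^^ k"
    then obtain z where z: "f y = f z" "(x, z) \<in> parcs G ^^ k" by (elim exE conjE)
    then have "z \<in> pverts G" using xy(1) sub by (cases k) auto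
    then show "(x, y) \<in> parcs G ^^ k" using z inj_onD[OF f(1) z(1) xy(2)] by simp
  next
    assume "(x, y) \<in> parcs G ^^ k"
    then show "\<exists>z. f y = f z \<and> (x, z) \<in> parcs G ^^ k" by (intro exI[of _ y] conjI refl)
  qed
  then have "(LEAST k. (f x, f y) \<in> parcs H ^^ k) = (LEAST k. (x, y) \<in> parcs G ^^ k)"
    unfolding f(3) relpow_image[OF f(1) sub xy(1)] by (simp only:)
  moreover have "f x \<in> pverts H" using xy(1) f(2) by blast
  ultimately show ?thesis
    unfolding G.graph_dist_relpow[OF xy(1)] H.graph_dist_relpow[OF \<open>f x \<in> pverts H\<close>]
    by (simp only:)
qed

lemma wiener_iso:
  assumes "pair_wf_digraph G" "pair_wf_digraph H" "digraph_iso (with_proj G) (with_proj H)"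
  shows "wiener G = wiener H"
proof -
  from assms(3)[unfolded digraph_iso_pair_iff[OF assms(1)]]
  obtain f where f: "inj_on f (pverts G)" "pverts H = f ` pverts G"
    "parcs H = map_prod f f ` parcs G" by (elim exE conjE)
  let ?T = "{e. e \<subseteq> pverts G \<and> card e = 2}"
  have inj: "inj_on ((`) f) ?T"
    by (rule inj_onI) (use inj_on_image_eq_iff[OF f(1)] in simp)
  have T: "{e. e \<subseteq> pverts H \<and> card e = 2} = (`) f ` ?T"
  proof -
    have "card (f ` e) = card e" if "e \<subseteq> pverts G" for e
      by (rule card_image[OF inj_on_subset[OF f(1) that]])
    then show ?thesis unfolding f(2) by (auto simp: subset_image_iff)
  qed
  have "wiener H = (\<Sum>e\<in>?T. THE d. \<exists>u v. f ` e = {u, v} \<and> d = graph_dist H u v)"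
    unfolding wiener_def T by (rule sum.reindex_cong[OF inj refl]) simp
  also have "\<dots> = wiener G"
    unfolding wiener_def
  proof (rule sum.cong[OF refl])
    fix e assume e: "e \<in> ?T"
    have "(\<exists>u v. f ` e = {u, v} \<and> d = graph_dist H u v) \<longleftrightarrow>
        (\<exists>u v. e = {u, v} \<and> d = graph_dist G u v)" for d
    proof
      assume "\<exists>u v. f ` e = {u, v} \<and> d = graph_dist H u v"
      then obtain u v where uv: "f ` e = {u, v}" "d = graph_dist H u v" by blast
      from uv(1) have "u \<in> f ` e" "v \<in> f ` e" by simp_all
      then obtain x y where "x \<in> e" "y \<in> e" "u = f x" "v = f y" by (elim imageE)
      moreover from this have "e = {x, y}"
        using uv(1) e inj_on_image_eq_iff[OF f(1), of e "{x, y}"] by auto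
      ultimately show "\<exists>u v. e = {u, v} \<and> d = graph_dist G u v"
        using uv(2) e graph_dist_image[OF assms(1,2) f, of x y] by auto
    next
      assume "\<exists>u v. e = {u, v} \<and> d = graph_dist G u v"
      then obtain x y where xy: "e = {x, y}" "d = graph_dist G x y" by blast
      then have "f ` e = {f x, f y} \<and> d = graph_dist H (f x) (f y)"
        using e graph_dist_image[OF assms(1,2) f, of x y] by auto
      then show "\<exists>u v. f ` e = {u, v} \<and> d = graph_dist H u v" by blast
    qed
    then show "(THE d. \<exists>u v. f ` e = {u, v} \<and> d = graph_dist H u v) =
        (THE d. \<exists>u v. e = {u, v} \<and> d = graph_dist G u v)" by (simp only:)
  qed
  finally show ?thesis by simp
qed

section \<open>A cycle with hanging trees\<close>

text \<open>The depth function \<open>dep\<close> only serves to make the parent map \<open>par\<close> well founded.\<close>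

locale cycle_with_trees =
  fixes Vs :: "'a set" and h :: nat and u :: "nat \<Rightarrow> 'a" and par :: "'a \<Rightarrow> 'a" and dep :: "'a \<Rightarrow> nat"
  assumes finite_Vs: "finite Vs" and h_ge_2: "2 \<le> h"
    and inj_u: "inj_on u {..<2*h}" and u_in_Vs: "u ` {..<2*h} \<subseteq> Vs"
    and par_in_Vs: "\<And>x. x \<in> Vs - u ` {..<2*h} \<Longrightarrow> par x \<in> Vs"
    and dep_par: "\<And>x. x \<in> Vs - u ` {..<2*h} \<Longrightarrow> dep (par x) < dep x"
begin

definition Off where "Off = Vs - u ` {..<2*h}"
definition up where "up = {(x, par x) | x. x \<in> Off}"
text \<open>The orientation is auxiliary, one arc per edge with the trees pointing towards the
  cycle; the graph itself is \<open>symcl base_arcs\<close>.\<close>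

definition base_arcs where "base_arcs = {(u i, u (Suc i mod (2*h))) | i. i < 2*h} \<union> up"
text \<open>An off-cycle vertex \<open>z\<close> stands for the bridge between \<open>z\<close> and
  \<open>par z\<close>. In this reading \<open>anc x\<close> is the set of bridges on the way from
  \<open>x\<close> to the cycle, and \<open>subtree z\<close> is the side of the bridge away from
  the cycle.\<close>

definition anc where "anc x = {z \<in> Off. (x, z) \<in> up\<^sup>*}"
definition idx where "idx x = (THE i. i < 2*h \<and> (x, u i) \<in> up\<^sup>*)"
definition subtree where "subtree z = {x \<in> Vs. z \<in> anc x}"
definition hung where "hung i = {x \<in> Off. idx x = i}"

lemma finite_Off: "finite Off"
  using finite_Vs by (simp add: Off_def)

lemma u_notin_Off: "i < 2*h \<Longrightarrow> u i \<notin> Off"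
  by (auto simp: Off_def)

lemma u_Vs: "i < 2*h \<Longrightarrow> u i \<in> Vs"
  using u_in_Vs by auto

lemma Off_Vs: "x \<in> Off \<Longrightarrow> x \<in> Vs"
  by (auto simp: Off_def)

lemma Vs_cases [consumes 1, case_names off cyc]: "x \<in> Vs \<Longrightarrow> (x \<in> Off \<Longrightarrow> P) \<Longrightarrow> (\<And>i. i < 2*h \<Longrightarrow> x = u i \<Longrightarrow> P) \<Longrightarrow> P"
  by (auto simp: Off_def)

lemma par_Vs: "x \<in> Off \<Longrightarrow> par x \<in> Vs" and dep_par_less: "x \<in> Off \<Longrightarrow> dep (par x) < dep x"
  using par_in_Vs dep_par by (auto simp: Off_def)

lemma up_iff: "(x, y) \<in> up \<longleftrightarrow> x \<in> Off \<and> y = par x"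
  by (auto simp: up_def)

lemma up_rtrancl_Off: "x \<in> Off \<Longrightarrow> (x, y) \<in> up\<^sup>* \<longleftrightarrow> y = x \<or> (par x, y) \<in> up\<^sup>*"
  by (metis converse_rtranclE converse_rtrancl_into_rtrancl rtrancl.rtrancl_refl up_iff)

lemma up_rtrancl_not_Off: "x \<notin> Off \<Longrightarrow> (x, y) \<in> up\<^sup>* \<longleftrightarrow> y = x"
  by (metis converse_rtranclE rtrancl.rtrancl_refl up_iff)

lemma up_rtrancl_dep: "(x, y) \<in> up\<^sup>* \<Longrightarrow> dep y \<le> dep x \<and> (dep y = dep x \<longrightarrow> y = x)"
  by (induction rule: rtrancl_induct) (fastforce simp: up_iff dest: dep_par_less)+

lemma anc_u: "i < 2*h \<Longrightarrow> anc (u i) = {}"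
  using u_notin_Off by (auto simp: anc_def up_rtrancl_not_Off)

lemma anc_not_Off: "x \<notin> Off \<Longrightarrow> anc x = {}"
  by (auto simp: anc_def up_rtrancl_not_Off)

lemma anc_Off: "x \<in> Off \<Longrightarrow> anc x = insert x (anc (par x))"
  by (auto simp: anc_def up_rtrancl_Off)

lemma anc_refl: "x \<in> Off \<Longrightarrow> x \<in> anc x"
  by (auto simp: anc_def)

lemma not_anc_par: "x \<in> Off \<Longrightarrow> x \<notin> anc (par x)"
  using up_rtrancl_dep dep_par_less by (fastforce simp: anc_def)

lemma anc_antisym: "x \<in> anc y \<Longrightarrow> y \<in> anc x \<Longrightarrow> x = y"
  unfolding anc_def using up_rtrancl_dep[of x y] up_rtrancl_dep[of y x] by auto

lemma anc_Off_sub: "anc x \<subseteq> Off"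
  by (auto simp: anc_def)

lemma finite_anc: "finite (anc x)"
  using finite_Off anc_Off_sub finite_subset by blast

lemma anc_trans: "x \<in> anc y \<Longrightarrow> z \<in> anc x \<Longrightarrow> z \<in> anc y"
  by (auto simp: anc_def)

text \<open>An off-cycle vertex has a single successor in \<open>up\<close> and a cycle vertex has
  none, so the climb from \<open>x\<close>, finite by \<open>dep\<close>, has one possible
  end.\<close>

lemma idx_ex1: "x \<in> Vs \<Longrightarrow> \<exists>!i. i < 2*h \<and> (x, u i) \<in> up\<^sup>*"
proof (induction "dep x" arbitrary: x rule: less_induct)
  case less
  from less.prems show ?case
  proof (cases rule: Vs_cases)
    case off
    then have "(x, u i) \<in> up\<^sup>* \<longleftrightarrow> (par x, u i) \<in> up\<^sup>*" if "i < 2*h" for i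
      using up_rtrancl_Off[OF off] u_notin_Off[OF that] by auto
    with less.hyps[OF dep_par_less[OF off] par_Vs[OF off]] show ?thesis by metis
  next
    case (cyc i)
    then show ?thesis
      using inj_u u_notin_Off[of i] by (auto simp: up_rtrancl_not_Off inj_on_def)
  qed
qed

lemma idx_u: "i < 2*h \<Longrightarrow> idx (u i) = i"
  unfolding idx_def using idx_ex1[OF u_Vs] by (intro the1_equality) auto

lemma idx_less: "x \<in> Vs \<Longrightarrow> idx x < 2*h" and idx_up: "x \<in> Vs \<Longrightarrow> (x, u (idx x)) \<in> up\<^sup>*"
  unfolding idx_def using theI'[OF idx_ex1] by auto

lemma idx_par: "x \<in> Off \<Longrightarrow> idx (par x) = idx x"
proof -
  assume x: "x \<in> Off"
  have "idx (par x) < 2*h \<and> (x, u (idx (par x))) \<in> up\<^sup>*"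
    using idx_less idx_up par_Vs[OF x] up_rtrancl_Off[OF x] by blast
  then show ?thesis
    using idx_ex1[OF Off_Vs[OF x]] by (simp add: idx_def the1_equality)
qed

end

text \<open>Deleting the opposite cycle edges from \<open>u l\<close> to \<open>u (l + 1)\<close> and from \<open>u (l + h)\<close> to \<open>u (l + h + 1)\<close> separates the indices in \<open>(l, l + h]\<close> from
  the others; \<open>side h i\<close> collects the cuts \<open>l\<close> for which \<open>i\<close> lies in that half.\<close>

definition side :: "nat \<Rightarrow> nat \<Rightarrow> nat set" where
  "side h i = {l. l < h \<and> l < i \<and> i \<le> l + h}"

definition cyc_dist :: "nat \<Rightarrow> nat \<Rightarrow> nat \<Rightarrow> nat" where
  "cyc_dist h i j = card (sym_diff (side h i) (side h j))"

lemma finite_side: "finite (side h i)"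
  by (auto simp: side_def)

text \<open>The edges leaving \<open>i\<close> and \<open>i + h\<close> cross the same cut: the
  first enters its half, the second leaves it. The wrap from \<open>2*h - 1\<close> to 0 fits
  because \<open>side h 0\<close> is empty.\<close>

lemma side_Suc_less: "i < h \<Longrightarrow> side h (Suc i mod (2*h)) = insert i (side h i) \<and> i \<notin> side h i"
  by (auto simp: side_def)

lemma side_Suc_ge:
  "h \<le> i \<Longrightarrow> i < 2*h \<Longrightarrow> side h i = insert (i - h) (side h (Suc i mod (2*h))) \<and> i - h \<notin> side h (Suc i mod (2*h))"
  by (cases "Suc i = 2*h") (auto simp: side_def)

lemma cyc_dist_pos: "i < 2*h \<Longrightarrow> j < 2*h \<Longrightarrow> i \<noteq> j \<Longrightarrow> 1 \<le> cyc_dist h i j"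
proof (induction i j rule: linorder_wlog)
  case (le i j)
  \<comment> \<open>\<open>l\<close> is the cut crossed by the edge leaving \<open>i\<close>. It
    separates \<open>i\<close> from \<open>j\<close> unless \<open>j\<close> is more than
    \<open>h\<close> ahead; then the cut crossed by the edge leaving \<open>j\<close> does.\<close>
  define l where "l = (if i < h then i else i - h)"
  have "l \<in> sym_diff (side h i) (side h j) \<or> j - h \<in> sym_diff (side h i) (side h j)"
    using le by (auto simp: side_def l_def)
  then show ?case
    using finite_side by (auto simp: cyc_dist_def Suc_le_eq card_gt_0_iff)
qed (simp add: cyc_dist_def Un_commute)

text \<open>Double counting by cuts: each of the \<open>h\<close> cuts has \<open>h\<close> indices
  on either side, so it separates any \<open>i\<close> from exactly \<open>h\<close>
  indices.\<close>

lemma cyc_dist_row_sum: "i < 2*h \<Longrightarrow> (\<Sum>j<2*h. cyc_dist h i j) = h * h"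
proof -
  assume i: "i < 2*h"
  let ?D = "\<lambda>j. sym_diff (side h i) (side h j)"
  have "(\<Sum>j<2*h. cyc_dist h i j) = (\<Sum>j<2*h. \<Sum>l<h. of_bool (l \<in> ?D j))"
  proof (rule sum.cong[OF refl])
    fix j
    have "?D j = {l \<in> {..<h}. l \<in> ?D j}" by (auto simp: side_def)
    then show "cyc_dist h i j = (\<Sum>l<h. of_bool (l \<in> ?D j))"
      unfolding cyc_dist_def by (simp add: sum.If_cases of_bool_def Int_def)
  qed
  also have "\<dots> = (\<Sum>l<h. \<Sum>j<2*h. of_bool (l \<in> ?D j))" by (rule sum.swap)
  also have "\<dots> = (\<Sum>l<h. h)"
  proof (rule sum.cong[OF refl])
    fix l assume l: "l \<in> {..<h}"
    have "(\<Sum>j<2*h. of_bool (l \<in> ?D j)) = card {j \<in> {..<2*h}. l \<in> ?D j}"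
      by (simp add: sum.If_cases of_bool_def Int_def)
    also have "{j \<in> {..<2*h}. l \<in> ?D j} = (if l \<in> side h i then {..<2*h} - {l<..l+h} else {l<..l+h})"
      using l by (auto simp: side_def)
    also have "card \<dots> = h"
      using l card_Diff_subset[of "{l<..l + h}" "{..<2*h}"] by (auto simp: subset_iff)
    finally show "(\<Sum>j<2*h. of_bool (l \<in> ?D j)) = h" .
  qed
  finally show ?thesis by simp
qed

lemma card_sym_diff_insert:
  assumes "finite X" "finite Y" "a \<notin> X" "a \<notin> Y"
  shows "card (sym_diff (insert a X) Y) = Suc (card (sym_diff X Y))"
proof -
  have "sym_diff (insert a X) Y = insert a (sym_diff X Y)" using assms by auto
  then show ?thesis using assms by simp
qed

lemma card_sym_diff_triangle:
  assumes "finite X" "finite Y" "finite Z"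
  shows "card (sym_diff X Z) \<le> card (sym_diff X Y) + card (sym_diff Y Z)"
proof -
  have "card (sym_diff X Z) \<le> card (sym_diff X Y \<union> sym_diff Y Z)"
    using assms by (intro card_mono) auto
  also have "\<dots> \<le> card (sym_diff X Y) + card (sym_diff Y Z)" by (rule card_Un_le)
  finally show ?thesis .
qed


section \<open>Distance as the number of separating cuts\<close>

context cycle_with_trees begin

text \<open>Coding \<open>x\<close> by the sets \<open>anc x\<close> and
  \<open>side h (idx x)\<close> maps the vertices into a hypercube, and this is the Hamming distance
  of the codes. Symmetry and the triangle inequality come for free; only the agreement with walk
  lengths concerns the graph.\<close>

definition tdist where "tdist x y = card (sym_diff (anc x) (anc y)) + cyc_dist h (idx x) (idx y)"

lemma tdist_sym: "tdist x y = tdist y x"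
  by (simp add: tdist_def cyc_dist_def Un_commute)

lemma tdist_refl: "tdist x x = 0"
  by (simp add: tdist_def cyc_dist_def)

lemma tdist_triangle: "tdist x z \<le> tdist x y + tdist y z"
  using card_sym_diff_triangle[OF finite_anc finite_anc finite_anc, of x z y]
    card_sym_diff_triangle[OF finite_side finite_side finite_side, of h "idx x" h "idx z" h "idx y"]
  by (simp add: tdist_def cyc_dist_def)

lemma next_u: "i < 2*h \<Longrightarrow> Suc i mod (2*h) < 2*h"
  by simp

lemma tdist_u: "i < 2*h \<Longrightarrow> j < 2*h \<Longrightarrow> tdist (u i) (u j) = cyc_dist h i j"
  by (simp add: tdist_def anc_u idx_u)

lemma cyc_dist_next:
  assumes "i < 2*h" shows "cyc_dist h i (Suc i mod (2*h)) = 1"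
proof (cases "i < h")
  case True
  then have "sym_diff (side h i) (side h (Suc i mod (2*h))) = {i}"
    using side_Suc_less[OF True] by auto
  then show ?thesis by (simp add: cyc_dist_def)
next
  case False
  then have "sym_diff (side h i) (side h (Suc i mod (2*h))) = {i - h}"
    using side_Suc_ge[of h i] assms by auto
  then show ?thesis by (simp add: cyc_dist_def)
qed

lemma tdist_par_left:
  assumes "x \<in> Off" "x \<notin> anc y"
  shows "tdist x y = Suc (tdist (par x) y)"
  unfolding tdist_def anc_Off[OF assms(1)] idx_par[OF assms(1)]
    card_sym_diff_insert[OF finite_anc finite_anc not_anc_par[OF assms(1)] assms(2)] by simp

lemma tdist_base_arc: "(x, y) \<in> base_arcs \<Longrightarrow> tdist x y = 1"
  unfolding base_arcs_def up_def
  using cyc_dist_next tdist_u next_u tdist_par_left not_anc_par tdist_refl by auto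

lemma tdist_arc: "(x, y) \<in> symcl base_arcs \<Longrightarrow> tdist x y = 1"
  using tdist_base_arc[of x y] tdist_base_arc[of y x] tdist_sym[of x y] by (auto simp: symcl_def)

lemma base_arcs_par: "x \<in> Off \<Longrightarrow> (x, par x) \<in> base_arcs"
  by (auto simp: base_arcs_def up_def)

lemma base_arcs_u: "i < 2*h \<Longrightarrow> (u i, u (Suc i mod (2*h))) \<in> base_arcs"
  by (auto simp: base_arcs_def)

lemma symclI1: "(x, y) \<in> R \<Longrightarrow> (x, y) \<in> symcl R" and symclI2: "(x, y) \<in> R \<Longrightarrow> (y, x) \<in> symcl R"
  by (force simp: symcl_def)+

lemma sym_symcl: "(x, y) \<in> symcl R \<Longrightarrow> (y, x) \<in> symcl R"
  by (force simp: symcl_def)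

lemma arcs_Vs: "(x, y) \<in> symcl base_arcs \<Longrightarrow> x \<in> Vs \<and> y \<in> Vs"
  using u_Vs next_u par_Vs Off_Vs by (auto simp: symcl_def base_arcs_def up_def)

text \<open>If \<open>j\<close> is at most \<open>h\<close> ahead of \<open>i\<close>, a forward
  step from \<open>i\<close> approaches \<open>j\<close>; otherwise the shorter way leads from
  \<open>j\<close> forwards through 0 to \<open>i\<close>, and \<open>j\<close> moves. Letting
  either end move avoids backward steps.\<close>

lemma cyc_dist_descent_less:
  assumes "i < j" "j < 2*h"
  shows "cyc_dist h i j = Suc (cyc_dist h (Suc i mod (2*h)) j) \<or>
         cyc_dist h i j = Suc (cyc_dist h i (Suc j mod (2*h)))"
proof (cases "j - i \<le> h")
  case True
  show ?thesis
  proof (cases "i < h")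
    case ih: True
    let ?S = "side h (Suc i mod (2*h))" and ?T = "side h j"
    have S: "?S = insert i (side h i)" "i \<notin> side h i" using side_Suc_less[OF ih] by auto
    have "i \<in> ?T" using assms True ih by (auto simp: side_def)
    then have "sym_diff (side h i) ?T = insert i (sym_diff ?S ?T)" "i \<notin> sym_diff ?S ?T"
      using S by auto
    then show ?thesis by (simp add: cyc_dist_def finite_side)
  next
    case ih: False
    let ?S = "side h (Suc i mod (2*h))" and ?T = "side h j"
    have S: "side h i = insert (i - h) ?S" "i - h \<notin> ?S" using side_Suc_ge[of h i] ih assms by auto
    have "i - h \<notin> ?T" using assms True ih by (auto simp: side_def)
    from card_sym_diff_insert[OF finite_side finite_side S(2) this] show ?thesis
      by (simp add: cyc_dist_def S(1))
  qed
next
  case False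
  let ?S = "side h (Suc j mod (2*h))"
  have S: "side h j = insert (j - h) ?S" "j - h \<notin> ?S" using side_Suc_ge[of h j] False assms by auto
  have "j - h \<notin> side h i" using assms False by (auto simp: side_def)
  from card_sym_diff_insert[OF finite_side finite_side S(2) this] show ?thesis
    by (simp add: cyc_dist_def S(1) Un_commute)
qed

text \<open>A vertex that is an ancestor of the other cannot approach it through its parent, so the
  descent is not demanded at a fixed end. Unless both vertices are on the cycle, antisymmetry of
  \<open>anc\<close> provides an off-cycle end that is no ancestor of the other.\<close>

lemma tdist_descent:
  assumes "x \<in> Vs" "y \<in> Vs" "x \<noteq> y"
  shows "(\<exists>x'. (x, x') \<in> symcl base_arcs \<and> tdist x y = Suc (tdist x' y)) \<or>
         (\<exists>y'. (y, y') \<in> symcl base_arcs \<and> tdist x y = Suc (tdist x y'))"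
proof -
  have off: "\<exists>x'. (x, x') \<in> symcl base_arcs \<and> tdist x y = Suc (tdist x' y)"
    if "x \<in> Off" "x \<notin> anc y" for x y
    using tdist_par_left[OF that] symclI1[OF base_arcs_par[OF that(1)]] by blast
  have cyc: "(\<exists>x'. (u i, x') \<in> symcl base_arcs \<and> tdist (u i) (u j) = Suc (tdist x' (u j))) \<or>
         (\<exists>y'. (u j, y') \<in> symcl base_arcs \<and> tdist (u i) (u j) = Suc (tdist (u i) y'))"
    if "i < j" "j < 2*h" for i j
    using cyc_dist_descent_less[OF that] that
      symclI1[OF base_arcs_u[of i]] symclI1[OF base_arcs_u[of j]] tdist_u next_u
    by (metis (no_types, lifting) order.strict_trans)
  consider "x \<in> Off" "x \<notin> anc y" | "y \<in> Off" "y \<notin> anc x" | "x \<notin> Off" "y \<notin> Off"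
    using anc_antisym[of x y] assms(3) anc_not_Off[of x] anc_not_Off[of y] by blast
  then show ?thesis
  proof cases
    case 1 then show ?thesis using off by blast
  next
    case 2 then show ?thesis using off[of y x] by (metis tdist_sym)
  next
    case 3
    with assms obtain i j where "i < 2*h" "j < 2*h" "x = u i" "y = u j"
      by (auto elim!: Vs_cases)
    then show ?thesis
      using cyc[of i j] cyc[of j i] assms(3) by (metis linorder_neqE_nat tdist_sym)
  qed
qed

lemma tdist_le_relpow: "(x, y) \<in> symcl base_arcs ^^ k \<Longrightarrow> tdist x y \<le> k"
proof (induction k arbitrary: y)
  case 0
  then show ?case by (simp add: tdist_refl)
next
  case (Suc k)
  from Suc.prems obtain w where "(x, w) \<in> symcl base_arcs ^^ k" "(w, y) \<in> symcl base_arcs"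
    by (rule relpow_Suc_E)
  then show ?case
    using Suc.IH[of w] tdist_arc[of w y] tdist_triangle[of x y w] by linarith
qed

lemma relpow_tdist: "x \<in> Vs \<Longrightarrow> y \<in> Vs \<Longrightarrow> (x, y) \<in> symcl base_arcs ^^ tdist x y"
proof (induction "tdist x y" arbitrary: x y rule: less_induct)
  case less
  show ?case
  proof (cases "x = y")
    case True
    then show ?thesis by (simp add: tdist_refl)
  next
    case False
    from tdist_descent[OF less.prems False] show ?thesis
    proof (elim disjE exE conjE)
      fix x' assume x': "(x, x') \<in> symcl base_arcs" "tdist x y = Suc (tdist x' y)"
      have "(x', y) \<in> symcl base_arcs ^^ tdist x' y"
        by (rule less.hyps) (use x' arcs_Vs less.prems in auto)
      then show ?thesis unfolding x'(2) by (rule relpow_Suc_I2[OF x'(1)])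
    next
      fix y' assume y': "(y, y') \<in> symcl base_arcs" "tdist x y = Suc (tdist x y')"
      have "(x, y') \<in> symcl base_arcs ^^ tdist x y'"
        by (rule less.hyps) (use y' arcs_Vs less.prems in auto)
      then show ?thesis unfolding y'(2) by (rule relpow_Suc_I[OF _ sym_symcl[OF y'(1)]])
    qed
  qed
qed

text \<open>Every arc has \<open>tdist\<close> 1, so by the triangle inequality no walk is shorter
  than \<open>tdist\<close>; conversely the descent builds a walk of exactly this length.\<close>

lemma Least_relpow_tdist:
  "x \<in> Vs \<Longrightarrow> y \<in> Vs \<Longrightarrow> (LEAST k. (x, y) \<in> symcl base_arcs ^^ k) = tdist x y"
  using relpow_tdist tdist_le_relpow by (intro Least_equality)

end

section \<open>The cut formula and the matching bound\<close>

lemma sum_split_pairs: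
  assumes "finite X" "S \<subseteq> X"
  shows "(\<Sum>x\<in>X. \<Sum>y\<in>X. of_bool ((x \<in> S) \<noteq> (y \<in> S))) = 2 * (card S * (card X - card S))"
proof -
  have D: "card {y \<in> X. y \<notin> S} = card X - card S" "{y \<in> X. y \<in> S} = S"
    using card_Diff_subset[of S X] assms finite_subset[OF assms(2,1)]
    by (auto simp: set_diff_eq Int_absorb1 intro: arg_cong[of _ _ card])
  have "(\<Sum>y\<in>X. of_bool ((x \<in> S) \<noteq> (y \<in> S))) = (if x \<in> S then card X - card S else card S)" for x
    using assms D by (simp add: Int_def)
  then show ?thesis
    using assms D by (simp add: sum.If_cases Int_absorb1 Int_def set_diff_eq[symmetric] algebra_simps)
qed

text \<open>For a positive entry, the other \<open>K - 1\<close> positive entries sum to at least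
  \<open>K - 1\<close>, so \<open>(e i - 1) * (E - e i - (K - 1))\<close> is nonnegative. This
  bounds \<open>e i * (E - e i)\<close> below by a linear expression in \<open>e i\<close>, whose
  sum depends only on \<open>E\<close> and \<open>K\<close>.\<close>

lemma quadratic_form_bound:
  fixes e :: "'i \<Rightarrow> int" and c :: "'i \<Rightarrow> 'i \<Rightarrow> int"
  assumes fin: "finite I" and nonneg: "\<And>i. i \<in> I \<Longrightarrow> 0 \<le> e i"
    and c0: "\<And>i j. i \<in> I \<Longrightarrow> j \<in> I \<Longrightarrow> 0 \<le> c i j"
    and c1: "\<And>i j. i \<in> I \<Longrightarrow> j \<in> I \<Longrightarrow> i \<noteq> j \<Longrightarrow> 1 \<le> c i j"
    and K: "K = int (card {i \<in> I. 0 < e i})" and E: "E = sum e I"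
  shows "(K - 1) * (2 * E - K) \<le> (\<Sum>i\<in>I. \<Sum>j\<in>I. e i * e j * c i j)"
proof -
  let ?P = "{i \<in> I. 0 < e i}"
  have EP: "E = sum e ?P"
    unfolding E using fin nonneg by (intro sum.mono_neutral_right) force+
  have "(\<Sum>i\<in>?P. (K - 2) * e i + (E - K + 1)) \<le> (\<Sum>i\<in>?P. e i * (E - e i))"
  proof (rule sum_mono)
    fix i assume i: "i \<in> ?P"
    have "sum e (?P - {i}) = E - e i"
      using fin i by (simp add: EP sum_diff1)
    moreover have "(\<Sum>j\<in>?P - {i}. 1) \<le> sum e (?P - {i})"
      by (rule sum_mono) auto
    ultimately have "K - 1 \<le> E - e i"
      using fin i by (simp add: K card_Diff_singleton card_gt_0_iff of_nat_diff Suc_le_eq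
          del: card_0_eq)
    then have "0 \<le> (e i - 1) * (E - e i - (K - 1))"
      using i by simp
    then show "(K - 2) * e i + (E - K + 1) \<le> e i * (E - e i)"
      by (simp add: algebra_simps)
  qed
  also have "\<dots> \<le> (\<Sum>i\<in>?P. \<Sum>j\<in>I. e i * e j * c i j)"
  proof (rule sum_mono)
    fix i assume i: "i \<in> ?P"
    have "e i * (E - e i) = (\<Sum>j\<in>I - {i}. e i * e j)"
      using fin i by (simp add: E sum_diff1 sum_distrib_left[symmetric])
    also have "\<dots> \<le> (\<Sum>j\<in>I - {i}. e i * e j * c i j)"
    proof (rule sum_mono)
      fix j assume j: "j \<in> I - {i}"
      then have "1 \<le> c i j" "0 \<le> e i * e j" using i c1[of i j] nonneg by auto
      then show "e i * e j \<le> e i * e j * c i j" using mult_left_mono by fastforce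
    qed
    also have "\<dots> \<le> (\<Sum>j\<in>I. e i * e j * c i j)"
      using fin i nonneg c0 by (intro sum_mono2) auto
    finally show "e i * (E - e i) \<le> (\<Sum>j\<in>I. e i * e j * c i j)" .
  qed
  also have "\<dots> \<le> (\<Sum>i\<in>I. \<Sum>j\<in>I. e i * e j * c i j)"
    using fin nonneg c0 by (intro sum_mono2) (auto intro!: sum_nonneg)
  also have "(\<Sum>i\<in>?P. (K - 2) * e i + (E - K + 1)) = (K - 1) * (2 * E - K)"
    by (simp add: sum.distrib sum_distrib_left[symmetric] EP[symmetric] K[symmetric])
      (simp add: algebra_simps)
  finally show ?thesis .
qed

context cycle_with_trees begin

lemma Vs_split: "Vs = u ` {..<2*h} \<union> Off" "u ` {..<2*h} \<inter> Off = {}"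
  using u_in_Vs by (auto simp: Off_def)

lemma finite_hung: "finite (hung i)"
  using finite_Off by (simp add: hung_def)

lemma sum_Off_idx: "(\<Sum>x\<in>Off. f (idx x)) = (\<Sum>i<2*h. card (hung i) * (f i :: nat))"
proof -
  have "(\<Sum>x\<in>Off. f (idx x)) = (\<Sum>i<2*h. \<Sum>x\<in>{x \<in> Off. idx x = i}. f (idx x))"
    by (rule sum.group[symmetric]) (use finite_Off idx_less Off_Vs in auto)
  also have "\<dots> = (\<Sum>i<2*h. card (hung i) * f i)"
    by (rule sum.cong) (auto simp: hung_def)
  finally show ?thesis .
qed

lemma sum_Vs_idx: "(\<Sum>x\<in>Vs. f (idx x)) = (\<Sum>i<2*h. (1 + card (hung i)) * (f i :: nat))"
proof -
  have "(\<Sum>x\<in>Vs. f (idx x)) = (\<Sum>x\<in>u ` {..<2*h}. f (idx x)) + (\<Sum>x\<in>Off. f (idx x))"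
    by (subst Vs_split(1), rule sum.union_disjoint) (use finite_Off Vs_split(2) in auto)
  also have "(\<Sum>x\<in>u ` {..<2*h}. f (idx x)) = (\<Sum>i<2*h. f i)"
    by (rule sum.reindex_cong[OF inj_u refl]) (simp add: idx_u)
  finally show ?thesis
    by (simp add: sum_Off_idx sum.distrib)
qed

lemma sum_hung: "(\<Sum>i<2*h. card (hung i)) = card Off"
  using sum_Off_idx[of "\<lambda>_. 1"] by simp

lemma card_Vs: "card Vs = 2*h + card Off"
  using card_Un_disjoint[OF _ finite_Off Vs_split(2)] card_image[OF inj_u] Vs_split(1) by simp

text \<open>The bridge of \<open>z\<close> separates \<open>x\<close> from \<open>y\<close> iff
  exactly one of them lies in \<open>subtree z\<close>. Summing over the pairs first leaves, for
  each bridge, the product of the sizes of its two sides.\<close>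

lemma sum_card_sym_diff_anc:
  "(\<Sum>x\<in>Vs. \<Sum>y\<in>Vs. card (sym_diff (anc x) (anc y)))
    = 2 * (\<Sum>z\<in>Off. card (subtree z) * (card Vs - card (subtree z)))"
proof -
  let ?b = "\<lambda>x y z. of_bool ((x \<in> subtree z) \<noteq> (y \<in> subtree z)) :: nat"
  have "card (sym_diff (anc x) (anc y)) = (\<Sum>z\<in>Off. ?b x y z)" if "x \<in> Vs" "y \<in> Vs" for x y
  proof -
    have "{z \<in> Off. (x \<in> subtree z) \<noteq> (y \<in> subtree z)} = sym_diff (anc x) (anc y)"
      using anc_Off_sub that by (auto simp: subtree_def)
    then show ?thesis using finite_Off by (simp add: Int_def)
  qed
  then have "(\<Sum>x\<in>Vs. \<Sum>y\<in>Vs. card (sym_diff (anc x) (anc y))) = (\<Sum>x\<in>Vs. \<Sum>y\<in>Vs. \<Sum>z\<in>Off. ?b x y z)"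
    by (intro sum.cong refl) auto
  also have "\<dots> = (\<Sum>x\<in>Vs. \<Sum>z\<in>Off. \<Sum>y\<in>Vs. ?b x y z)"
    by (intro sum.cong refl sum.swap)
  also have "\<dots> = (\<Sum>z\<in>Off. \<Sum>x\<in>Vs. \<Sum>y\<in>Vs. ?b x y z)"
    by (rule sum.swap)
  also have "\<dots> = (\<Sum>z\<in>Off. 2 * (card (subtree z) * (card Vs - card (subtree z))))"
    by (intro sum.cong refl sum_split_pairs finite_Vs) (auto simp: subtree_def)
  finally show ?thesis by (simp add: sum_distrib_left)
qed

text \<open>Ordered pairs are counted, so this is twice the sum over \<open>i < j\<close>.\<close>

definition cyc_form :: nat where
  "cyc_form = (\<Sum>i<2*h. \<Sum>j<2*h. card (hung i) * card (hung j) * cyc_dist h i j)"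

lemma cyc_dist_sym: "cyc_dist h i j = cyc_dist h j i"
  by (simp add: cyc_dist_def Un_commute)

text \<open>Each index carries \<open>1 + card (hung i)\<close> vertices. On expanding the product
  of two such weights, the constant and linear parts contain only row sums \<open>h * h\<close>; so
  only the quadratic part depends on where the trees hang.\<close>

lemma sum_cyc_dist:
  "(\<Sum>x\<in>Vs. \<Sum>y\<in>Vs. cyc_dist h (idx x) (idx y)) = 2 * h^3 + 2 * h^2 * card Off + cyc_form"
proof -
  let ?e = "\<lambda>i. card (hung i)" and ?c = "cyc_dist h"
  have "(\<Sum>x\<in>Vs. \<Sum>y\<in>Vs. ?c (idx x) (idx y)) = (\<Sum>x\<in>Vs. \<Sum>j<2*h. (1 + ?e j) * ?c (idx x) j)"
    by (intro sum.cong refl sum_Vs_idx)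
  also have "\<dots> = (\<Sum>i<2*h. (1 + ?e i) * (\<Sum>j<2*h. (1 + ?e j) * ?c i j))"
    by (rule sum_Vs_idx)
  also have "\<dots> = (\<Sum>i<2*h. \<Sum>j<2*h. ?c i j) + (\<Sum>i<2*h. ?e i * (\<Sum>j<2*h. ?c i j))
      + (\<Sum>i<2*h. \<Sum>j<2*h. ?e j * ?c i j) + cyc_form"
    by (simp add: cyc_form_def algebra_simps sum.distrib sum_distrib_left)
  also have "(\<Sum>i<2*h. \<Sum>j<2*h. ?e j * ?c i j) = (\<Sum>j<2*h. ?e j * (\<Sum>i<2*h. ?c j i))"
    by (subst sum.swap) (simp add: sum_distrib_left cyc_dist_sym)
  finally show ?thesis
    by (simp add: cyc_dist_row_sum sum_distrib_right[symmetric] sum_hung power2_eq_square power3_eq_cube)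
qed

lemma sum_tdist:
  "(\<Sum>x\<in>Vs. \<Sum>y\<in>Vs. tdist x y)
    = 2 * (\<Sum>z\<in>Off. card (subtree z) * (card Vs - card (subtree z)))
      + 2 * h^3 + 2 * h^2 * card Off + cyc_form"
  by (simp add: tdist_def sum.distrib sum_card_sym_diff_anc sum_cyc_dist)

section \<open>Matchings against a fractional vertex cover\<close>

lemma finite_subtree: "finite (subtree z)"
  using finite_Vs by (simp add: subtree_def)

lemma subtree_Off: "subtree z \<subseteq> Off"
  using anc_not_Off by (fastforce simp: subtree_def)

lemma card_subtree_le: "card (subtree z) \<le> card Off"
  using card_mono[OF finite_Off subtree_Off] .

lemma subtree_refl: "z \<in> Off \<Longrightarrow> z \<in> subtree z"
  by (simp add: subtree_def anc_refl Off_Vs)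

lemma card_subtree_pos: "z \<in> Off \<Longrightarrow> 1 \<le> card (subtree z)"
  using subtree_refl finite_subtree by (auto simp: Suc_le_eq card_gt_0_iff)

text \<open>These are the lower ends of the bridges that do not lead to a pendant vertex. Their
  number is the q of the overview, and the size of \<open>laden\<close> is its K.\<close>

definition inner where "inner = {z \<in> Off. 2 \<le> card (subtree z)}"
definition laden where "laden = {i. i < 2*h \<and> hung i \<noteq> {}}"

lemma par_neq: "x \<in> Off \<Longrightarrow> par x \<noteq> x"
  using dep_par_less by (metis less_irrefl)

lemma subtree_par:
  assumes "x \<in> Off" "par x \<in> Off"
  shows "x \<in> subtree (par x)" "subtree x \<subseteq> subtree (par x)" "par x \<notin> subtree x"
  using assms anc_Off[OF assms(1)] anc_refl[OF assms(2)] Off_Vs[OF assms(1)] not_anc_par[OF assms(1)]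
  by (auto simp: subtree_def intro: anc_trans)

lemma par_inner:
  assumes "x \<in> Off" "par x \<in> Off" shows "par x \<in> inner"
proof -
  have "{x, par x} \<subseteq> subtree (par x)"
    using subtree_par(1)[OF assms] subtree_refl[OF assms(2)] by simp
  then have "card {x, par x} \<le> card (subtree (par x))"
    by (rule card_mono[OF finite_subtree])
  then have "2 \<le> card (subtree (par x))"
    using par_neq[OF assms(1)] by simp
  then show ?thesis using assms(2) by (simp add: inner_def)
qed

lemma matching_card_le:
  assumes M: "M \<subseteq> {{x, y} | x y. (x, y) \<in> symcl base_arcs}"
    and disj: "\<forall>e\<in>M. \<forall>f\<in>M. e \<noteq> f \<longrightarrow> e \<inter> f = {}"
  shows "2 * card M \<le> card Vs"
proof -
  have edge: "e \<subseteq> Vs \<and> finite e \<and> card e = 2" if e: "e \<in> M" for e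
  proof -
    from e M obtain x y where xy: "e = {x, y}" "(x, y) \<in> symcl base_arcs" by blast
    then have "x \<noteq> y" using tdist_arc[of x y] tdist_refl by force
    then show ?thesis using xy arcs_Vs by auto
  qed
  have "2 * card M = (\<Sum>e\<in>M. card e)" using edge by simp
  also have "\<dots> = card (\<Union>M)"
    using card_Union_disjoint[of M] edge disj by (auto simp: pairwise_def disjnt_def)
  also have "\<dots> \<le> card Vs"
    using edge finite_Vs by (intro card_mono) auto
  finally show ?thesis .
qed

text \<open>Weak linear programming duality: half of \<open>w\<close> is a fractional vertex cover.
  An unladen cycle vertex has neighbours on the cycle only, where all weights are at least 1, so
  weight 1 suffices for it.\<close>

lemma matching_bound:
  assumes M: "M \<subseteq> {{x, y} | x y. (x, y) \<in> symcl base_arcs}"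
    and disj: "\<forall>e\<in>M. \<forall>f\<in>M. e \<noteq> f \<longrightarrow> e \<inter> f = {}"
  shows "2 * card M \<le> 2 * card inner + 2 * h + card laden"
proof -
  define w where "w x = (if x \<in> Off then if x \<in> inner then 2 else 0
    else if idx x \<in> laden then 2 else (1::nat))" for x
  have sub: "e \<subseteq> Vs" if "e \<in> M" for e using M that arcs_Vs by auto
  have fin: "finite e" if "e \<in> M" for e using M that by auto
  have finM: "finite M" using sub finite_Vs by (meson Pow_iff finite_Pow_iff finite_subset subsetI)
  have edge: "x \<noteq> y \<and> 2 \<le> w x + w y" if "(x, y) \<in> base_arcs" for x y
    using that unfolding base_arcs_def
  proof (elim UnE CollectE exE conjE)
    fix i assume i: "(x, y) = (u i, u (Suc i mod (2*h)))" "i < 2*h"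
    have "x \<noteq> y" using cyc_dist_next[OF i(2)] tdist_u[OF i(2) next_u[OF i(2)]] i tdist_refl by auto
    then show ?thesis
      using i u_notin_Off next_u[OF i(2)] by (auto simp: w_def)
  next
    assume "(x, y) \<in> up"
    then have x: "x \<in> Off" "y = par x" by (auto simp: up_iff)
    have "x \<noteq> y" using par_neq[OF x(1)] x(2) by simp
    moreover have "w y = 2"
    proof (cases "y \<in> Off")
      case True
      then have "y \<in> inner" using par_inner[of x] x by blast
      with True show ?thesis by (simp add: w_def)
    next
      case False
      have "x \<in> hung (idx y)"
        using x(1) by (simp add: x(2) idx_par hung_def)
      moreover have "idx y < 2*h"
        using idx_less[OF par_Vs[OF x(1)]] by (simp add: x(2))
      ultimately have "idx y \<in> laden" by (auto simp: laden_def)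
      then show ?thesis using False by (simp add: w_def)
    qed
    ultimately show ?thesis by simp
  qed
  have "2 * card M = (\<Sum>e\<in>M. 2)" by simp
  also have "\<dots> \<le> (\<Sum>e\<in>M. sum w e)"
  proof (rule sum_mono)
    fix e assume "e \<in> M"
    then obtain x y where e: "e = {x, y}" "(x, y) \<in> symcl base_arcs" using M by blast
    then have "(x, y) \<in> base_arcs \<or> (y, x) \<in> base_arcs" by (auto simp: symcl_def)
    then show "2 \<le> sum w e" using edge[of x y] edge[of y x] e(1) by auto
  qed
  also have "\<dots> = sum w (\<Union>M)"
    using fin disj by (simp add: sum.Union_disjoint)
  also have "\<dots> \<le> sum w Vs"
    using sub finite_Vs by (intro sum_mono2) auto
  also have "\<dots> = sum w (u ` {..<2*h}) + sum w Off"
    by (subst Vs_split(1), rule sum.union_disjoint) (use finite_Off Vs_split(2) in auto)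
  also have "sum w (u ` {..<2*h}) = (\<Sum>i<2*h. 1 + of_bool (i \<in> laden))"
    by (rule sum.reindex_cong[OF inj_u refl]) (simp add: idx_u w_def u_notin_Off)
  also have "\<dots> = 2 * h + card laden"
    unfolding sum.distrib by (simp add: laden_def Int_def)
  also have "sum w Off = (\<Sum>x\<in>Off. 2 * of_bool (x \<in> inner))"
    by (rule sum.cong) (auto simp: w_def)
  also have "\<dots> = 2 * card inner"
    using finite_Off by (simp add: sum_distrib_left[symmetric] inner_def Int_def)
  finally show ?thesis by simp
qed

end

section \<open>Lower bound and unicyclic graphs\<close>

context cycle_with_trees begin

lemma pair_wf:
  assumes "pverts G = Vs" "parcs G = symcl base_arcs"
  shows "pair_wf_digraph G"
  by unfold_locales (use assms arcs_Vs in force)+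

lemma wiener_tdist:
  assumes G: "pverts G = Vs" "parcs G = symcl base_arcs"
  shows "2 * wiener G = (\<Sum>x\<in>Vs. \<Sum>y\<in>Vs. tdist x y)"
proof -
  have d: "graph_dist G x y = tdist x y" if "x \<in> Vs" "y \<in> Vs" for x y
    using pair_wf_digraph.graph_dist_relpow[OF pair_wf[OF G], of x y] Least_relpow_tdist[OF that] that G
    by simp
  have "2 * wiener G = (\<Sum>x\<in>pverts G. \<Sum>y\<in>pverts G. graph_dist G x y)"
    by (rule wiener_double_sum) (use G d finite_Vs tdist_refl tdist_sym in auto)
  then show ?thesis using d G(1) by simp
qed

lemma wiener_formula:
  assumes G: "pverts G = Vs" "parcs G = symcl base_arcs"
  shows "2 * int (wiener G) =
    2 * (\<Sum>z\<in>Off. int (card (subtree z)) * (int (card Vs) - int (card (subtree z))))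
      + 2 * int h ^ 3 + 2 * int h ^ 2 * int (card Off) + int cyc_form"
proof -
  have "int (card Vs - card (subtree z)) = int (card Vs) - int (card (subtree z))" for z
    using card_subtree_le[of z] card_Vs by (simp add: of_nat_diff)
  moreover have "2 * int (wiener G) = int (2 * wiener G)" by simp
  ultimately show ?thesis
    unfolding wiener_tdist[OF G] sum_tdist by simp
qed

lemma cyc_form_bound:
  "(int (card laden) - 1) * (2 * int (card Off) - int (card laden)) \<le> int cyc_form"
proof -
  have "(int (card laden) - 1) * (2 * int (card Off) - int (card laden)) \<le>
    (\<Sum>i<2*h. \<Sum>j<2*h. int (card (hung i)) * int (card (hung j)) * int (cyc_dist h i j))"
  proof (rule quadratic_form_bound)
    have "laden = {i \<in> {..<2*h}. 0 < int (card (hung i))}"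
      using finite_hung by (auto simp: laden_def card_gt_0_iff)
    then show "int (card laden) = int (card {i \<in> {..<2*h}. 0 < int (card (hung i))})" by simp
    show "int (card Off) = (\<Sum>i<2*h. int (card (hung i)))"
      by (simp add: sum_hung[symmetric])
    show "1 \<le> int (cyc_dist h i j)" if "i \<in> {..<2*h}" "j \<in> {..<2*h}" "i \<noteq> j" for i j
      using cyc_dist_pos[of i h j] that by simp
  qed auto
  then show ?thesis by (simp add: cyc_form_def)
qed

text \<open>\<open>W\<close> is the value at two laden positions, \<open>q\<close> inner vertices,
  subtrees of size at most 2 and least \<open>cyc_form\<close>. Twice the difference to
  \<open>W\<close> is a combination of three nonnegative defects, so equality makes all of them
  vanish. Here \<open>q\<close> is the target number of inner vertices, and \<open>d\<close> the
  possibly negative excess over it.\<close>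

lemma wiener_bound:
  assumes G: "pverts G = Vs" "parcs G = symcl base_arcs"
    and matched: "2 * \<beta> \<le> 2 * card inner + 2 * h + card laden"
    and le: "2 * \<beta> \<le> card Vs" and ge: "3 * h \<le> \<beta>"
  defines "n \<equiv> int (card Vs)" and "E \<equiv> int (card Off)" and "q \<equiv> int \<beta> - int h - 1"
  defines "W \<equiv> (n - 1) * (E - q) + 2 * (n - 2) * q + int h ^ 3 + int h ^ 2 * E + E - 1"
  shows "W \<le> int (wiener G)"
    and "int (wiener G) = W \<Longrightarrow> card laden = 2 \<and> int (card inner) = q \<and>
      (\<forall>z\<in>Off. card (subtree z) \<le> 2) \<and> int cyc_form = 2 * (E - 1)"
proof -
  define K where "K = int (card laden)"
  define d where "d = int (card inner) - q"
  define H where "H = int h"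
  let ?k = "\<lambda>z. int (card (subtree z))"
  define m where "m z = (if z \<in> inner then 2 * (n - 2) else n - 1)" for z
  define P where "P = (\<Sum>z\<in>Off. ?k z * (n - ?k z))"
  have nE: "n = E + 2 * H" by (simp add: n_def E_def H_def card_Vs)
  have H2: "2 \<le> H" using h_ge_2 by (simp add: H_def)
  \<comment> \<open>From \<open>n \<ge> 2 * \<beta> \<ge> 6 * h\<close> and
    \<open>n = E + 2 * h\<close>. This keeps the factor \<open>E - 2 * H - K + 2\<close> below
    positive for every \<open>K\<close> up to \<open>2 * H\<close>.\<close>
  have E4: "4 * H \<le> E" using le ge nE by (simp add: n_def H_def)
  have "laden \<noteq> {}"
  proof
    assume "laden = {}"
    then have "(\<Sum>i<2*h. card (hung i)) = 0" by (auto simp: laden_def)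
    then show False using sum_hung E4 H2 by (simp add: E_def)
  qed
  moreover have lsub: "laden \<subseteq> {..<2*h}" by (auto simp: laden_def)
  ultimately have K1: "1 \<le> K"
    using finite_subset[OF lsub] by (simp add: K_def Suc_le_eq card_gt_0_iff)
  have K2: "K \<le> 2 * H" using card_mono[OF _ lsub] by (simp add: K_def H_def)
  have dK: "2 - K \<le> 2 * d" using matched by (simp add: d_def q_def K_def)
  have kE: "?k z \<le> E" for z using card_subtree_le[of z] by (simp add: E_def)
  \<comment> \<open>The last summand is \<open>k * (n - k) - 2 * (n - 2)\<close> in factored form.
    The whole cycle lies on the other side of the bridge, so \<open>k \<le> E\<close> and
    \<open>n - 2 - k\<close> is positive.\<close>
  have gap: "?k z * (n - ?k z) = m z + (if z \<in> inner then (?k z - 2) * (n - 2 - ?k z) else 0)"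
    if "z \<in> Off" for z
  proof (cases "z \<in> inner")
    case True then show ?thesis by (simp add: m_def algebra_simps)
  next
    case False
    then have "card (subtree z) = 1" using that card_subtree_pos[OF that] by (simp add: inner_def)
    then show ?thesis using False by (simp add: m_def)
  qed
  have gap0: "0 \<le> (?k z - 2) * (n - 2 - ?k z)" if "z \<in> inner" for z
    using that kE[of z] nE H2 by (simp add: inner_def)
  have "(\<Sum>z\<in>Off. if z \<in> inner then 2 * (n - 2) else n - 1) =
      2 * (n - 2) * int (card inner) + (n - 1) * int (card (Off - inner))"
  proof -
    have "Off \<inter> {z. z \<in> inner} = inner" "Off \<inter> - {z. z \<in> inner} = Off - inner"
      by (auto simp: inner_def)
    then show ?thesis using finite_Off by (simp add: sum.If_cases)
  qed
  moreover have "int (card (Off - inner)) = E - int (card inner)"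
    using card_Diff_subset[of inner Off] card_mono[OF finite_Off, of inner] finite_Off finite_subset[of inner Off]
    by (simp add: E_def inner_def of_nat_diff subset_iff)
  \<comment> \<open>One more inner vertex costs \<open>2 * (n - 2) - (n - 1) = n - 3\<close>, the
    coefficient of \<open>d\<close>.\<close>
  ultimately have m: "sum m Off = (n - 1) * (E - q) + 2 * (n - 2) * q + d * (n - 3)"
    by (simp add: m_def d_def algebra_simps)
  have Pm: "sum m Off \<le> P"
    unfolding P_def by (rule sum_mono) (use gap gap0 in auto)
  \<comment> \<open>The third defect weighs inner vertices against laden positions, which
    \<open>dK\<close> allows to be exchanged at a rate of one for two.\<close>
  define X where "X = 2 * d * (n - 3) + (K - 1) * (2 * E - K) - 2 * (E - 1)"
  have W: "2 * int (wiener G) - 2 * W = 2 * (P - sum m Off) + (int cyc_form - (K - 1) * (2 * E - K)) + X"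
    unfolding wiener_formula[OF G] m W_def X_def P_def n_def[symmetric] E_def[symmetric]
    by (simp add: algebra_simps)
  have cyc: "(K - 1) * (2 * E - K) \<le> int cyc_form"
    using cyc_form_bound by (simp add: K_def E_def)
  have X: "0 \<le> X \<and> (X = 0 \<longrightarrow> K = 2 \<and> d = 0)"
  proof (cases "K = 1")
    case True
    \<comment> \<open>Integrality is essential here: \<open>dK\<close> only says \<open>1 \<le> 2 * d\<close>, and \<open>d = 1 / 2\<close> would not suffice.\<close>
    then have "1 \<le> d" using dK by simp
    then have "n - 3 \<le> d * (n - 3)" using nE H2 E4 by simp
    then have "0 < X" using True nE H2 by (simp add: X_def)
    then show ?thesis by simp
  next
    case False
    with K1 have K: "2 \<le> K" by simp
    have "(2 - K) * (n - 3) \<le> 2 * d * (n - 3)"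
      using dK nE H2 E4 by (intro mult_right_mono) auto
    \<comment> \<open>At the extreme value \<open>2 * d = 2 - K\<close> the expression
      \<open>X\<close> is divisible by \<open>K - 2\<close>; by \<open>E4\<close> and
      \<open>K2\<close> the cofactor is at least 2.\<close>
    then have "(K - 2) * (E - 2 * H - K + 2) \<le> X"
      unfolding X_def nE by (simp add: algebra_simps)
    moreover have "(K - 2) * 1 \<le> (K - 2) * (E - 2 * H - K + 2)"
      using K K2 E4 by (intro mult_left_mono) auto
    ultimately have "K - 2 \<le> X" by simp
    moreover have "d = 0" if "X = 0" "K = 2"
      using that nE H2 E4 by (simp add: X_def)
    ultimately show ?thesis using K by force
  qed
  show "W \<le> int (wiener G)" using W Pm cyc X by simp
  assume "int (wiener G) = W"
  with W Pm cyc X have eq: "P = sum m Off" "int cyc_form = (K - 1) * (2 * E - K)" "K = 2" "d = 0"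
    by auto
  have "card (subtree z) \<le> 2" if z: "z \<in> Off" for z
  proof (rule ccontr)
    assume neg: "\<not> ?thesis"
    then have "z \<in> inner" using z by (simp add: inner_def)
    moreover have "0 < (?k z - 2) * (n - 2 - ?k z)"
      using neg kE[of z] nE H2 by simp
    ultimately have "m z < ?k z * (n - ?k z)" using gap[OF z] by simp
    with z have "\<exists>z\<in>Off. m z < ?k z * (n - ?k z)" by blast
    moreover have "\<forall>z\<in>Off. m z \<le> ?k z * (n - ?k z)" using gap gap0 by simp
    ultimately have "sum m Off < P"
      unfolding P_def using finite_Off by (intro sum_strict_mono_ex1)
    with eq(1) show False by simp
  qed
  with eq show "card laden = 2 \<and> int (card inner) = q \<and>
      (\<forall>z\<in>Off. card (subtree z) \<le> 2) \<and> int cyc_form = 2 * (E - 1)"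
    by (simp add: K_def d_def)
qed

end

section \<open>From a unicyclic graph to a cycle with hanging trees\<close>

lemma pcas_nth: "pcas a p b \<Longrightarrow> Suc i < length p \<Longrightarrow> snd (p ! i) = fst (p ! Suc i)"
proof (induction p arbitrary: a i)
  case (Cons x p)
  then show ?case by (cases p; cases i) auto
qed simp

lemma pcas_ends: "pcas a p b \<Longrightarrow> p \<noteq> [] \<Longrightarrow> fst (hd p) = a \<and> snd (last p) = b"
  by (induction p arbitrary: a) auto

text \<open>The list required to be distinct is the vertex list without its first entry, that is
  \<open>map snd p\<close>. Hence the indexing by heads, in which the arc from \<open>u i\<close> to
  its successor is the cyclically next entry \<open>i + 1\<close> of \<open>p\<close>.\<close>

lemma (in pair_wf_digraph) cycle_index:
  assumes "cycle p"
  defines "u \<equiv> \<lambda>i. snd (p ! i)"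
  shows "inj_on u {..<length p}" "set p = {(u i, u (Suc i mod length p)) | i. i < length p}"
proof -
  let ?L = "length p"
  from assms(1) obtain a where a: "awalk a p a" "distinct (tl (awalk_verts a p))" "p \<noteq> []"
    unfolding cycle_def by blast
  then have cas: "pcas a p a" by (simp add: awalk_def)
  have "tl (awalk_verts a p) = map snd p"
    using awalk_verts_conv'[OF cas] a(3) by simp
  then have "distinct (map snd p)" using a(2) by simp
  then show "inj_on u {..<?L}"
    by (auto simp: inj_on_def u_def distinct_conv_nth)
  have next_arc: "p ! (Suc i mod ?L) = (u i, u (Suc i mod ?L))" if "i < ?L" for i
  proof (cases "Suc i = ?L")
    case True
    then have "snd (p ! i) = fst (p ! 0)"
      using pcas_ends[OF cas a(3)] a(3) True[symmetric] by (simp add: last_conv_nth hd_conv_nth)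
    then show ?thesis using True by (simp add: u_def prod_eq_iff)
  next
    case False
    then show ?thesis using pcas_nth[OF cas, of i] that by (simp add: u_def prod_eq_iff)
  qed
  show "set p = {(u i, u (Suc i mod ?L)) | i. i < ?L}"
  proof (intro equalityI subsetI)
    fix e assume "e \<in> set p"
    then obtain j where j: "j < ?L" "e = p ! j" by (metis in_set_conv_nth)
    define i where "i = (if j = 0 then ?L - 1 else j - 1)"
    have "i < ?L" "Suc i mod ?L = j" using j by (auto simp: i_def)
    then show "e \<in> {(u i, u (Suc i mod ?L)) | i. i < ?L}" using next_arc[of i] j by auto
  next
    fix e assume "e \<in> {(u i, u (Suc i mod ?L)) | i. i < ?L}"
    then obtain i where "i < ?L" "e = p ! (Suc i mod ?L)" using next_arc by auto
    moreover have "Suc i mod ?L < ?L" using a(3) by simp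
    ultimately show "e \<in> set p" by simp
  qed
qed

text \<open>Two of these edges coinciding in opposite orientation would mean that two steps lead
  back to the start, which \<open>3 \<le> L\<close> excludes. This links the girth, a number of
  edges, to the length of the walk.\<close>

lemma card_cycle_edges:
  assumes "inj_on u {..<L}" "3 \<le> L"
  shows "card {{u i, u (Suc i mod L)} | i. i < L} = L"
proof -
  have "inj_on (\<lambda>i. {u i, u (Suc i mod L)}) {..<L}"
  proof (rule inj_onI)
    fix i j assume ij: "i \<in> {..<L}" "j \<in> {..<L}" "{u i, u (Suc i mod L)} = {u j, u (Suc j mod L)}"
    have m: "Suc i mod L \<in> {..<L}" "Suc j mod L \<in> {..<L}" using assms(2) by auto
    from ij(3) consider "u i = u j" | "u i = u (Suc j mod L)" "u (Suc i mod L) = u j"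
      by (auto simp: doubleton_eq_iff)
    then show "i = j"
    proof cases
      case 1 then show ?thesis using ij(1,2) inj_onD[OF assms(1)] by blast
    next
      case 2
      then have "i = Suc j mod L" "Suc i mod L = j"
        using ij(1,2) m inj_onD[OF assms(1)] by blast+
      then show ?thesis using ij(1,2) assms(2)
        by (cases "Suc j = L"; cases "Suc i = L") auto
    qed
  qed
  then have "card ((\<lambda>i. {u i, u (Suc i mod L)}) ` {..<L}) = L" by (simp add: card_image)
  moreover have "(\<lambda>i. {u i, u (Suc i mod L)}) ` {..<L} = {{u i, u (Suc i mod L)} | i. i < L}" by auto
  ultimately show ?thesis by simp
qed

text \<open>A path in \<open>G'\<close> avoids the edge between \<open>x\<close> and
  \<open>y\<close>, so this edge closes it to a cycle. Any edge beyond the spanning structure thus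
  lies on a cycle.\<close>

lemma (in pair_graph) closing_edge_cycle:
  assumes xy: "(y, x) \<in> parcs G" "x \<noteq> y"
    and G': "pair_wf_digraph G'" "parcs G' \<subseteq> parcs G - {(x, y), (y, x)}" "pverts G' \<subseteq> pverts G"
    and walk: "x \<in> pverts G'" "(x, y) \<in> parcs G' ^^ k"
  shows "\<exists>p. cycle p \<and> 3 \<le> length p \<and> (y, x) \<in> set p"
proof -
  interpret G': pair_wf_digraph G' by fact
  from G'.relpow_awalk[OF walk] obtain p0 where "G'.awalk x p0 y" by blast
  from G'.apath_awalk_to_apath[OF this] obtain p where p: "G'.apath x p y" by blast
  then have aw: "x \<in> pverts G'" "set p \<subseteq> parcs G'" "pcas x p y" and dist: "distinct (pawalk_verts x p)"
    by (simp_all add: G'.apath_def G'.awalk_def)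
  have ne: "p \<noteq> []" using aw(3) xy(2) by auto
  \<comment> \<open>A single arc from \<open>x\<close> to \<open>y\<close> would be the deleted one.
    Two arcs are needed so that the closed walk has length at least 3.\<close>
  have "length p \<noteq> 1"
  proof
    assume "length p = 1"
    then obtain e where "p = [e]" by (auto simp: length_Suc_conv)
    then have "e = (x, y)" "e \<in> parcs G'" using aw by (auto simp: prod_eq_iff)
    then show False using G'(2) by auto
  qed
  with ne have len: "2 \<le> length p" by (cases p) (auto simp: Suc_le_eq)
  have "awalk x p y" using aw G'(2,3) by (auto simp: awalk_def)
  moreover have "awalk y [(y, x)] x" using xy(1) in_arcsD2[OF xy(1)] by (simp add: awalk_simps)
  ultimately have w: "awalk x (p @ [(y, x)]) x" by (rule awalk_appendI)
  have "pawalk_verts x (p @ [(y, x)]) = pawalk_verts x p @ [x]"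
    using awalk_verts_conv[of x p] awalk_verts_conv[of x "p @ [(y, x)]"] pcas_ends[OF aw(3) ne] ne by simp
  moreover have "pawalk_verts x p = x # tl (pawalk_verts x p)"
    using awalk_verts_conv'[OF aw(3)] pcas_ends[OF aw(3) ne] ne by simp
  \<comment> \<open>The tail of the new vertex list is the old list rotated by one place.\<close>
  ultimately have "distinct (tl (pawalk_verts x (p @ [(y, x)])))"
    using dist by (metis distinct.simps(2) distinct1_rotate list.sel(3) rotate1.simps(2) tl_append2 list.distinct(1))
  then have "cycle (p @ [(y, x)])" unfolding cycle_def using w by blast
  then show ?thesis using len by (intro exI[of _ "p @ [(y, x)]"]) simp
qed

lemma relpow_subset:
  fixes R S :: "'a rel"
  assumes "R \<subseteq> S" shows "R ^^ k \<subseteq> S ^^ k"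
  by (induction k) (use assms in auto)

text \<open>Parents nearer to the cycle make \<open>symcl base_arcs\<close> a connected spanning
  subgraph. An edge outside it would close a cycle with a walk avoiding it; by uniqueness this cycle
  is \<open>C\<close>, so the edge is a cycle edge after all.\<close>

lemma unicyclic_structure:
  assumes uni: "unicyclic G" and girth: "unicyclic_girth G = 2 * h"
  shows "\<exists>u par dep. cycle_with_trees (pverts G) h u par dep \<and>
    parcs G = symcl (cycle_with_trees.base_arcs (pverts G) h u par)"
proof -
  from uni have pg: "pair_graph G" and conn: "connected (with_proj G)"
    and ex1: "\<exists>!C. C \<in> cycle_edge_sets G" by (auto simp: unicyclic_def)
  interpret pair_graph G by (rule pg)
  from ex1 obtain C where C: "C \<in> cycle_edge_sets G" "\<And>C'. C' \<in> cycle_edge_sets G \<Longrightarrow> C' = C" by blast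
  from C(1) obtain p where p: "C = (\<lambda>(u, v). {u, v}) ` set p" "cycle p" "3 \<le> length p"
    by (auto simp: cycle_edge_sets_def)
  define u where "u i = snd (p ! i)" for i
  have inj: "inj_on u {..<length p}" and setp: "set p = {(u i, u (Suc i mod length p)) | i. i < length p}"
    unfolding u_def using cycle_index[OF p(2)] by simp_all
  have C_eq: "C = {{u i, u (Suc i mod length p)} | i. i < length p}"
    unfolding p(1) setp by (auto simp: image_iff)
  have "card C = 2 * h"
    using girth ex1 C by (metis unicyclic_girth_def theI')
  then have L: "length p = 2 * h" using card_cycle_edges[OF inj p(3)] C_eq by simp
  from p(2) have sub: "set p \<subseteq> parcs G" by (auto simp: cycle_def awalk_def)
  have carc: "(u i, u (Suc i mod (2*h))) \<in> parcs G" if "i < 2*h" for i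
    using sub that unfolding setp L by blast
  have h2: "2 \<le> h" using p(3) L by simp
  have "strongly_connected (with_proj G)"
    using symmetric_connected_imp_strongly_connected conn sym_arcs by blast
  then have reach: "\<exists>k. (x, u 0) \<in> parcs G ^^ k" if "x \<in> pverts G" for x
  proof -
    have "u 0 \<in> pverts G" using carc[of 0] h2 in_arcsD1 by simp
    with \<open>strongly_connected _\<close> that have "x \<rightarrow>\<^sup>*\<^bsub>with_proj G\<^esub> u 0" by (simp add: strongly_connected_def)
    then obtain q where "awalk x q (u 0)" using reachable_awalk by blast
    then show ?thesis using awalk_relpow by blast
  qed
  \<comment> \<open>The distance to the cycle; the first arc of a shortest walk to the cycle leads
    to a possible parent.\<close>
  define dep where "dep x = (LEAST k. \<exists>i<2*h. (x, u i) \<in> parcs G ^^ k)" for x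
  define par where "par x = (SOME y. (x, y) \<in> parcs G \<and> dep y < dep x)" for x
  have par: "(x, par x) \<in> parcs G \<and> dep (par x) < dep x" if x: "x \<in> pverts G - u ` {..<2*h}" for x
  proof -
    have "\<exists>k. \<exists>i<2*h. (x, u i) \<in> parcs G ^^ k" using reach[of x] x h2 by (metis Diff_iff less_le_trans mult_pos_pos pos2 zero_less_numeral)
    from LeastI_ex[OF this] obtain i where i: "i < 2*h" "(x, u i) \<in> parcs G ^^ dep x"
      unfolding dep_def by blast
    have "dep x \<noteq> 0" using i x by (metis DiffE image_eqI lessThan_iff relpow_0_E)
    then obtain k where k: "dep x = Suc k" using not0_implies_Suc by blast
    from i(2)[unfolded k] obtain y where y: "(x, y) \<in> parcs G" "(y, u i) \<in> parcs G ^^ k"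
      by (rule relpow_Suc_E2)
    have "dep y \<le> k" unfolding dep_def by (rule Least_le) (use i(1) y(2) in blast)
    then show ?thesis unfolding par_def using someI[of "\<lambda>y. (x, y) \<in> parcs G \<and> dep y < dep x" y] y(1) k by simp
  qed
  interpret T: cycle_with_trees "pverts G" h u par dep
  proof
    show "finite (pverts G)" by (rule pair_finite_verts)
    show "2 \<le> h" by (rule h2)
    show "inj_on u {..<2*h}" using inj L by simp
    show "u ` {..<2*h} \<subseteq> pverts G" using carc in_arcsD1 by auto
    show "par x \<in> pverts G" "dep (par x) < dep x" if "x \<in> pverts G - u ` {..<2*h}" for x
      using par[OF that] in_arcsD2 by auto
  qed
  have base: "T.base_arcs \<subseteq> parcs G"
    using carc par by (auto simp: T.base_arcs_def T.up_def T.Off_def)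
  have "parcs G = symcl T.base_arcs"
  proof (intro equalityI subsetI)
    fix e assume "e \<in> symcl T.base_arcs"
    then show "e \<in> parcs G" using base arcs_symmetric by (auto simp: symcl_def)
  next
    fix e assume e: "e \<in> parcs G"
    obtain x y where xy: "e = (x, y)" by (cases e)
    show "e \<in> symcl T.base_arcs"
    proof (rule ccontr)
      assume neg: "e \<notin> symcl T.base_arcs"
      let ?G' = "\<lparr>pverts = pverts G, parcs = parcs G - {(x, y), (y, x)}\<rparr>"
      have wf: "pair_wf_digraph ?G'"
        by unfold_locales (auto dest: wellformed')
      have V: "x \<in> pverts G" "y \<in> pverts G" using e xy in_arcsD1 in_arcsD2 by auto
      have "symcl T.base_arcs \<subseteq> parcs ?G'"
        using base neg xy arcs_symmetric T.sym_symcl[of y x T.base_arcs] by (auto simp: symcl_def)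
      then have "(x, y) \<in> parcs ?G' ^^ T.tdist x y"
        using T.relpow_tdist[OF V] relpow_subset by blast
      moreover have "(y, x) \<in> parcs G" "x \<noteq> y" using e xy arcs_symmetric no_loops' by auto
      ultimately have "\<exists>p. cycle p \<and> 3 \<le> length p \<and> (y, x) \<in> set p"
        using wf V by (intro closing_edge_cycle[of y x ?G']) auto
      then obtain q where q: "cycle q" "3 \<le> length q" "(y, x) \<in> set q" by blast
      have "(\<lambda>(u, v). {u, v}) ` set q \<in> cycle_edge_sets G"
        using q(1,2) by (auto simp: cycle_edge_sets_def)
      then have "{y, x} \<in> C" using C(2) q(3) by (metis (mono_tags, lifting) case_prod_conv image_eqI)
      then obtain i where "i < 2*h" "{y, x} = {u i, u (Suc i mod (2*h))}" unfolding C_eq L by blast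
      then have "(x, y) \<in> symcl T.base_arcs"
        using T.symclI1[OF T.base_arcs_u[of i]] T.symclI2[OF T.base_arcs_u[of i]]
        by (auto simp: doubleton_eq_iff)
      with neg xy show False by simp
    qed
  qed
  then show ?thesis using T.cycle_with_trees_axioms by blast
qed

section \<open>The extremal graph\<close>

text \<open>\<open>U\<close> counts from 1 and the locale from 0, hence \<open>Suc\<close>.
  \<open>Root\<close> is absent because \<open>embed_tree\<close> identifies it with
  \<open>U 1\<close>.\<close>

definition star_verts :: "nat \<Rightarrow> nat \<Rightarrow> nat \<Rightarrow> g_vertex set" where
  "star_verts h a b = (\<lambda>i. U (Suc i)) ` {..<2*h} \<union> (\<lambda>i. Tr (Leaf i)) ` {1..a + b} \<union> (\<lambda>i. Tr (Pend i)) ` {1..a} \<union> {V}"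

text \<open>The first three equations cover all off-cycle vertices; the last one is a default
  value.\<close>

fun star_par :: "g_vertex \<Rightarrow> g_vertex" where
  "star_par (Tr (Leaf i)) = U 1"
| "star_par (Tr (Pend i)) = Tr (Leaf i)"
| "star_par V = U 2"
| "star_par x = x"

fun star_dep :: "g_vertex \<Rightarrow> nat" where
  "star_dep (Tr (Leaf i)) = 1"
| "star_dep (Tr (Pend i)) = 2"
| "star_dep V = 1"
| "star_dep x = 0"

lemma star_cycle_with_trees:
  assumes "2 \<le> h"
  shows "cycle_with_trees (star_verts h a b) h (\<lambda>i. U (Suc i)) star_par star_dep"
proof
  have U: "U i \<in> star_verts h a b" if "1 \<le> i" "i \<le> 2*h" for i
  proof -
    have "i - 1 \<in> {..<2*h}" "U i = U (Suc (i - 1))" using that by auto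
    then show ?thesis unfolding star_verts_def by blast
  qed
  fix x assume "x \<in> star_verts h a b - (\<lambda>i. U (Suc i)) ` {..<2*h}"
  then consider i where "x = Tr (Leaf i)" | i where "i \<in> {1..a}" "x = Tr (Pend i)" | "x = V"
    by (auto simp: star_verts_def)
  then have "star_par x \<in> star_verts h a b \<and> star_dep (star_par x) < star_dep x"
    by cases (use U[of 1] U[of 2] assms in \<open>auto simp: star_verts_def\<close>)
  then show "star_par x \<in> star_verts h a b" "star_dep (star_par x) < star_dep x" by auto
qed (use assms in \<open>auto simp: star_verts_def inj_on_def\<close>)

lemma star_Off:
  "star_verts h a b - (\<lambda>i. U (Suc i)) ` {..<2*h} =
    (\<lambda>i. Tr (Leaf i)) ` {1..a + b} \<union> (\<lambda>i. Tr (Pend i)) ` {1..a} \<union> {V}"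
  by (auto simp: star_verts_def)

lemma symcl_Un: "symcl (R \<union> S) = symcl R \<union> symcl S"
  by (auto simp: symcl_def)

lemma symcl_converse: "symcl (R\<inverse>) = symcl R"
  by (force simp: symcl_def)

lemma symcl_image: "symcl (map_prod f f ` R) = map_prod f f ` symcl R"
  by (force simp: symcl_def)

text \<open>This makes the construction an instance of the locale. Its tree arcs are written away
  from the cycle whereas \<open>up\<close> points towards it; the symmetric closure absorbs the
  difference.\<close>

lemma
  assumes "2 \<le> h" and a: "a = \<beta> - h - 1" and b: "b = n + 1 - 2 * \<beta>"
  shows pverts_G_star: "pverts (G_star n (2*h) \<beta>) = star_verts h a b"
    and parcs_G_star: "parcs (G_star n (2*h) \<beta>) =
      symcl (cycle_with_trees.base_arcs (star_verts h a b) h (\<lambda>i. U (Suc i)) star_par)"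
proof -
  interpret T: cycle_with_trees "star_verts h a b" h "\<lambda>i. U (Suc i)" star_par star_dep
    by (rule star_cycle_with_trees[OF assms(1)])
  have cyc: "U ` {1..2*h} = (\<lambda>i. U (Suc i)) ` {..<2*h}"
    by (simp add: image_image[symmetric, of U Suc] image_Suc_lessThan)
  have tree: "embed_tree ` pverts (T_star a b) =
      insert (U 1) ((\<lambda>i. Tr (Leaf i)) ` {1..a + b} \<union> (\<lambda>i. Tr (Pend i)) ` {1..a})"
    by (auto simp: T_star_def embed_tree_def image_iff)
  have G_star: "G_star n (2*h) \<beta> = \<lparr>
      pverts = U ` {1..2*h} \<union> embed_tree ` pverts (T_star a b) \<union> {V},
      parcs = symcl ({(U i, U (i + 1)) | i. i \<in> {1..<2*h}} \<union> {(U (2*h), U 1)})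
        \<union> map_prod embed_tree embed_tree ` parcs (T_star a b) \<union> symcl {(U 2, V)}\<rparr>"
    unfolding G_star_def Let_def a b by simp
  have "U 1 \<in> (\<lambda>i. U (Suc i)) ` {..<2*h}" using assms(1) by force
  then show "pverts (G_star n (2*h) \<beta>) = star_verts h a b"
    unfolding G_star pair_pre_digraph.simps tree cyc star_verts_def by blast
  have c1: "{(U i, U (i + 1)) | i. i \<in> {1..<2*h}} \<union> {(U (2*h), U 1)} =
      {(U (Suc i), U (Suc (Suc i mod (2*h)))) | i. i < 2*h}" (is "?A = ?B")
  proof (intro equalityI subsetI)
    fix e assume "e \<in> ?A"
    then consider i where "1 \<le> i" "i < 2*h" "e = (U i, U (i + 1))" | "e = (U (2*h), U 1)" by auto
    then show "e \<in> ?B"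
    proof cases
      case 1 then show ?thesis by (auto intro!: exI[of _ "i - 1"])
    next
      case 2 then show ?thesis using assms(1) by (auto intro!: exI[of _ "2*h - 1"])
    qed
  next
    fix e assume "e \<in> ?B"
    then obtain i where "i < 2*h" "e = (U (Suc i), U (Suc (Suc i mod (2*h))))" by blast
    then show "e \<in> ?A" by (cases "Suc i = 2*h") auto
  qed
  have tr: "map_prod embed_tree embed_tree ` parcs (T_star a b) =
      symcl ({(U 1, Tr (Leaf i)) | i. i \<in> {1..a + b}} \<union> {(Tr (Leaf i), Tr (Pend i)) | i. i \<in> {1..a}})"
      (is "_ = symcl ?X")
    unfolding T_star_def pair_pre_digraph.simps symcl_image[symmetric]
    by (rule arg_cong[of _ _ symcl]) (simp add: setcompr_eq_image image_Un image_image embed_tree_def)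
  have up: "T.up = (?X \<union> {(U 2, V)})\<inverse>"
    unfolding T.up_def T.Off_def star_Off by auto
  show "parcs (G_star n (2*h) \<beta>) = symcl T.base_arcs"
    unfolding G_star pair_pre_digraph.simps c1 tr T.base_arcs_def up
    by (simp only: symcl_Un symcl_converse Un_assoc)
qed

section \<open>Wiener index of the extremal graph\<close>

context
  fixes h a b :: nat
  assumes h: "2 \<le> h"
begin

interpretation T: cycle_with_trees "star_verts h a b" h "\<lambda>i. U (Suc i)" star_par star_dep
  by (rule star_cycle_with_trees[OF h])

lemma star_Off_eq: "T.Off = (\<lambda>i. Tr (Leaf i)) ` {1..a + b} \<union> (\<lambda>i. Tr (Pend i)) ` {1..a} \<union> {V}"
  unfolding T.Off_def star_Off ..

lemma star_anc:
  "i \<in> {1..a + b} \<Longrightarrow> T.anc (Tr (Leaf i)) = {Tr (Leaf i)}"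
  "i \<in> {1..a} \<Longrightarrow> T.anc (Tr (Pend i)) = {Tr (Pend i), Tr (Leaf i)}"
  "T.anc V = {V}"
proof -
  have U: "T.anc (U i) = {}" for i by (rule T.anc_not_Off) (auto simp: star_Off_eq)
  show L: "T.anc (Tr (Leaf i)) = {Tr (Leaf i)}" if "i \<in> {1..a + b}" for i
    using T.anc_Off[of "Tr (Leaf i)"] that U by (auto simp: star_Off_eq)
  show "T.anc (Tr (Pend i)) = {Tr (Pend i), Tr (Leaf i)}" if "i \<in> {1..a}" for i
    using T.anc_Off[of "Tr (Pend i)"] that L[of i] by (auto simp: star_Off_eq)
  show "T.anc V = {V}"
    using T.anc_Off[of V] U by (auto simp: star_Off_eq)
qed

lemma star_idx:
  "i \<in> {1..a + b} \<Longrightarrow> T.idx (Tr (Leaf i)) = 0"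
  "i \<in> {1..a} \<Longrightarrow> T.idx (Tr (Pend i)) = 0"
  "T.idx V = 1"
proof -
  have U: "T.idx (U 1) = 0" "T.idx (U 2) = 1" using T.idx_u[of 0] T.idx_u[of 1] h by (auto simp: numeral_2_eq_2)
  show L: "T.idx (Tr (Leaf i)) = 0" if "i \<in> {1..a + b}" for i
    using T.idx_par[of "Tr (Leaf i)"] that U by (auto simp: star_Off_eq)
  show "T.idx (Tr (Pend i)) = 0" if "i \<in> {1..a}" for i
    using T.idx_par[of "Tr (Pend i)"] that L[of i] by (auto simp: star_Off_eq)
  show "T.idx V = 1"
    using T.idx_par[of V] U by (auto simp: star_Off_eq)
qed

lemma star_subtree_Off: "T.subtree z = {x \<in> T.Off. z \<in> T.anc x}"
  using T.subtree_Off T.Off_Vs by (auto simp: T.subtree_def)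

lemma star_subtree:
  "i \<in> {1..a} \<Longrightarrow> T.subtree (Tr (Leaf i)) = {Tr (Leaf i), Tr (Pend i)}"
  "i \<in> {a + 1..a + b} \<Longrightarrow> T.subtree (Tr (Leaf i)) = {Tr (Leaf i)}"
  "i \<in> {1..a} \<Longrightarrow> T.subtree (Tr (Pend i)) = {Tr (Pend i)}"
  "T.subtree V = {V}"
  unfolding star_subtree_Off star_Off_eq using star_anc by auto

lemma star_hung:
  "T.hung 0 = (\<lambda>i. Tr (Leaf i)) ` {1..a + b} \<union> (\<lambda>i. Tr (Pend i)) ` {1..a}"
  "T.hung 1 = {V}"
  "2 \<le> i \<Longrightarrow> T.hung i = {}"
  unfolding T.hung_def star_Off_eq using star_idx by auto

lemma star_card_Off: "card T.Off = 2 * a + b + 1"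
proof -
  have "card T.Off = card ((\<lambda>i. Tr (Leaf i)) ` {1..a + b} \<union> (\<lambda>i. Tr (Pend i)) ` {1..a}) + 1"
    unfolding star_Off_eq by (subst card_Un_disjoint) auto
  also have "card ((\<lambda>i. Tr (Leaf i)) ` {1..a + b} \<union> (\<lambda>i. Tr (Pend i)) ` {1..a}) = (a + b) + a"
    by (subst card_Un_disjoint) (auto simp: card_image inj_on_def)
  finally show ?thesis by simp
qed

text \<open>There are two loads only, \<open>2 * a + b\<close> at index 0 and 1 at index 1, at
  distance 1; ordered pairs give the factor 2.\<close>

lemma star_cyc_form: "T.cyc_form = 2 * (2 * a + b)"
proof -
  have h1: "card (T.hung 1) = 1" using star_hung by simp
  have "T.Off = insert V (T.hung 0)" "V \<notin> T.hung 0"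
    unfolding star_hung star_Off_eq by auto
  then have h0: "card (T.hung 0) = 2 * a + b"
    using star_card_Off T.finite_hung[of 0] by simp
  have *: "(\<Sum>i<2*h. card (T.hung i) * f i) = card (T.hung 0) * f 0 + f 1" for f :: "nat \<Rightarrow> nat"
  proof -
    have "(\<Sum>i<2*h. card (T.hung i) * f i) = (\<Sum>i\<in>{0, 1}. card (T.hung i) * f i)"
      by (rule sum.mono_neutral_right) (use h star_hung(3) in \<open>auto simp: numeral_2_eq_2 Suc_le_eq\<close>)
    then show ?thesis using h1 by simp
  qed
  have c: "cyc_dist h 0 1 = 1" "cyc_dist h 1 0 = 1" "cyc_dist h i i = 0" for i
    using T.cyc_dist_next[of 0] T.cyc_dist_sym[of 1 0] h by (auto simp: cyc_dist_def)
  have "T.cyc_form = (\<Sum>i<2*h. card (T.hung i) * (\<Sum>j<2*h. card (T.hung j) * cyc_dist h i j))"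
    by (simp add: T.cyc_form_def sum_distrib_left mult.assoc)
  then show ?thesis unfolding * by (simp add: c h0 del: One_nat_def)
qed

lemma star_inner_sum:
  fixes N :: int
  shows "(\<Sum>z\<in>T.Off. int (card (T.subtree z)) * (N - int (card (T.subtree z)))) =
    2 * (N - 2) * int a + (N - 1) * (int a + int b + 1)"
proof -
  let ?F = "\<lambda>z. int (card (T.subtree z)) * (N - int (card (T.subtree z)))"
  have "sum ?F T.Off = sum ?F ((\<lambda>i. Tr (Leaf i)) ` {1..a}) + sum ?F ((\<lambda>i. Tr (Leaf i)) ` {a + 1..a + b})
      + sum ?F ((\<lambda>i. Tr (Pend i)) ` {1..a}) + ?F V"
  proof -
    have off: "T.Off = (\<lambda>i. Tr (Leaf i)) ` {1..a} \<union> (\<lambda>i. Tr (Leaf i)) ` {a + 1..a + b} \<union> (\<lambda>i. Tr (Pend i)) ` {1..a} \<union> {V}"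
    proof -
      have "{1..a + b} = {1..a} \<union> {a + 1..a + b}" by auto
      then show ?thesis unfolding star_Off_eq by (simp only: image_Un)
    qed
    have split: "sum ?F (A \<union> B \<union> C \<union> {V}) = sum ?F A + sum ?F B + sum ?F C + ?F V"
      if "finite A" "finite B" "finite C" "A \<inter> B = {}" "(A \<union> B) \<inter> C = {}" "V \<notin> A \<union> B \<union> C" for A B C
      using that by (simp add: sum.union_disjoint)
    show ?thesis unfolding off by (rule split) auto
  qed
  also have "sum ?F ((\<lambda>i. Tr (Leaf i)) ` {1..a}) = (\<Sum>i\<in>{1..a}. 2 * (N - 2))"
    by (rule sum.reindex_cong[of "\<lambda>i. Tr (Leaf i)"]) (auto simp: inj_on_def star_subtree)
  also have "sum ?F ((\<lambda>i. Tr (Leaf i)) ` {a + 1..a + b}) = (\<Sum>i\<in>{a + 1..a + b}. N - 1)"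
    by (rule sum.reindex_cong[of "\<lambda>i. Tr (Leaf i)"]) (auto simp: inj_on_def star_subtree)
  also have "sum ?F ((\<lambda>i. Tr (Pend i)) ` {1..a}) = (\<Sum>i\<in>{1..a}. N - 1)"
    by (rule sum.reindex_cong[of "\<lambda>i. Tr (Pend i)"]) (auto simp: inj_on_def star_subtree)
  finally show ?thesis by (simp add: star_subtree algebra_simps)
qed

lemma wiener_star:
  assumes G: "pverts G = star_verts h a b" "parcs G = symcl T.base_arcs"
  defines "N \<equiv> 2 * int h + 2 * int a + int b + 1"
  shows "int (wiener G) = 2 * (N - 2) * int a + (N - 1) * (int a + int b + 1)
    + int h ^ 3 + int h ^ 2 * (2 * int a + int b + 1) + 2 * int a + int b"
proof -
  have "int (card (star_verts h a b)) = N"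
    using T.card_Vs star_card_Off by (simp add: N_def)
  then show ?thesis
    using T.wiener_formula[OF G] unfolding star_inner_sum star_card_Off star_cyc_form
    by (simp add: algebra_simps)
qed

end

section \<open>The equality case\<close>

text \<open>The loaded positions must become 0 and 1 in this order. A rotation does this if
  \<open>i1\<close> follows \<open>i0\<close>; otherwise a reflection is needed, and the second
  alternative records the reversed orientation.\<close>

lemma cycle_rotation:
  assumes i: "i0 < m" "i1 < m" and adj: "i1 = Suc i0 mod m \<or> i0 = Suc i1 mod m" and m: "2 \<le> m"
  shows "\<exists>\<sigma>. bij_betw \<sigma> {..<m} {..<m} \<and> \<sigma> i0 = 0 \<and> \<sigma> i1 = 1 \<and>
    ((\<forall>i<m. \<sigma> (Suc i mod m) = Suc (\<sigma> i) mod m) \<or> (\<forall>i<m. \<sigma> i = Suc (\<sigma> (Suc i mod m)) mod m))"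
proof -
  have nx: "Suc i mod m = (if Suc i = m then 0 else Suc i)" if "i < m" for i
    using that by simp
  have bij: "bij_betw \<sigma> {..<m} {..<m}" if "inj_on \<sigma> {..<m}" "\<And>i. i < m \<Longrightarrow> \<sigma> i < m" for \<sigma> :: "nat \<Rightarrow> nat"
    using endo_inj_surj[of "{..<m}" \<sigma>] that by (auto simp: bij_betw_def)
  show ?thesis
  proof (cases "i1 = Suc i0 mod m")
    case True
    define \<sigma> where "\<sigma> i = (if i0 \<le> i then i - i0 else i + m - i0)" for i
    have lt: "\<sigma> i < m" if "i < m" for i using that i by (auto simp: \<sigma>_def)
    have "inj_on \<sigma> {..<m}" using i by (auto simp: inj_on_def \<sigma>_def split: if_splits)
    moreover have "\<sigma> (Suc i mod m) = Suc (\<sigma> i) mod m" if "i < m" for i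
      unfolding nx[OF that] nx[OF lt[OF that]] using that i by (auto simp: \<sigma>_def)
    moreover have "\<sigma> i0 = 0" "\<sigma> i1 = 1" using True i m nx[OF i(1)] by (auto simp: \<sigma>_def)
    ultimately show ?thesis using bij lt by blast
  next
    case False
    then have a: "i0 = Suc i1 mod m" using adj by blast
    define \<sigma> where "\<sigma> i = (if i \<le> i0 then i0 - i else i0 + m - i)" for i
    have lt: "\<sigma> i < m" if "i < m" for i using that i by (auto simp: \<sigma>_def)
    have "inj_on \<sigma> {..<m}" using i by (auto simp: inj_on_def \<sigma>_def split: if_splits)
    moreover have "\<sigma> i = Suc (\<sigma> (Suc i mod m)) mod m" if "i < m" for i
    proof -
      have l: "Suc i mod m < m" using m by simp
      show ?thesis
        unfolding nx[OF lt[OF l]] unfolding nx[OF that] using that i by (auto simp: \<sigma>_def)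
    qed
    moreover have "\<sigma> i0 = 0" "\<sigma> i1 = 1" using a i m nx[OF i(2)] by (auto simp: \<sigma>_def)
    ultimately show ?thesis using bij lt by blast
  qed
qed

text \<open>The equation reads \<open>(x - 1) * (y - 1) + x * y * (c - 1) = 0\<close> with
  nonnegative summands. It is applied to two loads and their distance.\<close>

lemma product_eq_sum_minus_one:
  fixes x y c :: int
  assumes "x * y * c = x + y - 1" "1 \<le> x" "1 \<le> y" "1 \<le> c"
  shows "c = 1 \<and> (x = 1 \<or> y = 1)"
proof -
  have "(x - 1) * (y - 1) + x * y * (c - 1) = 0" using assms(1) by (simp add: algebra_simps)
  moreover have "0 \<le> (x - 1) * (y - 1)" "0 \<le> x * y * (c - 1)" using assms by simp_all
  ultimately have "(x - 1) * (y - 1) = 0" "x * y * (c - 1) = 0" by linarith+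
  then show ?thesis using assms by auto
qed

section \<open>Structure of the graphs attaining the bound\<close>

context cycle_with_trees begin

text \<open>For loads \<open>x\<close> and \<open>y\<close> at distance \<open>c\<close>,
  \<open>cyc_form\<close> is \<open>2 * x * y * c\<close> and \<open>card Off\<close> is
  \<open>x + y\<close>, so the least value forces \<open>c = 1\<close> and a load of 1. The names
  \<open>i0\<close>, \<open>i1\<close> are assigned last, as either load may be the single
  one.\<close>

lemma extremal_cycle_positions:
  assumes "card laden = 2" and "int cyc_form = 2 * (int (card Off) - 1)"
  shows "\<exists>i0 i1. laden = {i0, i1} \<and> i0 < 2*h \<and> i1 < 2*h \<and> i0 \<noteq> i1 \<and> card (hung i1) = 1 \<and>
    (i1 = Suc i0 mod (2*h) \<or> i0 = Suc i1 mod (2*h))"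
proof -
  from assms(1) obtain j k where jk: "laden = {j, k}" "j \<noteq> k" by (auto simp: card_2_iff)
  then have lt: "j < 2*h" "k < 2*h" and ne: "hung j \<noteq> {}" "hung k \<noteq> {}" by (auto simp: laden_def)
  let ?e = "\<lambda>i. card (hung i)" and ?c = "cyc_dist h j k"
  have pos: "1 \<le> ?e j" "1 \<le> ?e k" using ne finite_hung by (auto simp: Suc_le_eq card_gt_0_iff)
  have unladen: "hung i = {}" if "i < 2*h" "i \<noteq> j" "i \<noteq> k" for i
    using that jk(1) unfolding laden_def by blast
  have red: "(\<Sum>i<2*h. ?e i * f i) = ?e j * f j + ?e k * f k" for f :: "nat \<Rightarrow> nat"
  proof -
    have "(\<Sum>i<2*h. ?e i * f i) = (\<Sum>i\<in>{j, k}. ?e i * f i)"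
      by (rule sum.mono_neutral_right) (use lt unladen in auto)
    then show ?thesis using jk(2) by simp
  qed
  have E: "card Off = ?e j + ?e k" using red[of "\<lambda>_. 1"] sum_hung by simp
  have "cyc_form = (\<Sum>i<2*h. ?e i * (\<Sum>l<2*h. ?e l * cyc_dist h i l))"
    by (simp add: cyc_form_def sum_distrib_left mult.assoc)
  also have "\<dots> = 2 * (?e j * ?e k * ?c)"
    unfolding red using cyc_dist_sym[of k j] by (simp add: cyc_dist_def)
  finally have "int (?e j) * int (?e k) * int ?c = int (?e j) + int (?e k) - 1"
    using assms(2) E by simp
  then have "int ?c = 1 \<and> (int (?e j) = 1 \<or> int (?e k) = 1)"
    using pos cyc_dist_pos[OF lt jk(2)] by (intro product_eq_sum_minus_one) auto
  then have one: "?e j = 1 \<or> ?e k = 1" and c: "?c = 1" by auto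
  have next_idx: "b = Suc a mod (2*h)" if "(u a, u b) \<in> base_arcs" "a < 2*h" "b < 2*h" for a b
  proof -
    from that(1) u_notin_Off[OF that(2)] obtain i where i: "i < 2*h" "u a = u i" "u b = u (Suc i mod (2*h))"
      by (auto simp: base_arcs_def up_def)
    then have "a = i" "b = Suc i mod (2*h)"
      using inj_onD[OF inj_u i(2)] inj_onD[OF inj_u i(3)] that next_u[OF i(1)] by auto
    then show ?thesis by simp
  qed
  \<comment> \<open>Distance 1 gives a walk of one arc, whose orientation is unknown.\<close>
  have "(u j, u k) \<in> symcl base_arcs"
    using relpow_tdist[OF u_Vs u_Vs, OF lt] tdist_u[OF lt] c by simp
  then have "(u j, u k) \<in> base_arcs \<or> (u k, u j) \<in> base_arcs"
    by (auto simp: symcl_def)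
  then have adj: "k = Suc j mod (2*h) \<or> j = Suc k mod (2*h)"
    using next_idx[OF _ lt] next_idx[OF _ lt(2,1)] by blast
  from one show ?thesis
  proof
    assume "?e k = 1"
    then show ?thesis using jk lt adj by (intro exI[of _ j] exI[of _ k] conjI)
  next
    assume "?e j = 1"
    moreover have "laden = {k, j}" using jk(1) by (simp add: insert_commute)
    moreover have "j = Suc k mod (2*h) \<or> k = Suc j mod (2*h)" using adj by blast
    ultimately show ?thesis using jk(2)[symmetric] lt by (intro exI[of _ k] exI[of _ j] conjI)
  qed
qed

text \<open>Subtrees of at most two vertices give each inner vertex exactly one child. So
  \<open>Off\<close> consists of inner vertices, their children, \<open>b\<close> pendant neighbours
  of \<open>u i0\<close> and the lone vertex \<open>v\<close> at \<open>u i1\<close>, the same four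
  classes as in the star.\<close>

lemma extremal_iso:
  assumes laden: "card laden = 2" and cf: "int cyc_form = 2 * (int (card Off) - 1)"
    and inner: "card inner = a" and small: "\<forall>z\<in>Off. card (subtree z) \<le> 2"
    and off: "card Off = 2 * a + b + 1"
  shows "\<exists>f. inj_on f Vs \<and> star_verts h a b = f ` Vs \<and>
    symcl (cycle_with_trees.base_arcs (star_verts h a b) h (\<lambda>i. U (Suc i)) star_par) =
      map_prod f f ` symcl base_arcs"
proof -
  interpret S: cycle_with_trees "star_verts h a b" h "\<lambda>i. U (Suc i)" star_par star_dep
    by (rule star_cycle_with_trees[OF h_ge_2])
  obtain i0 i1 where i: "laden = {i0, i1}" "i0 < 2*h" "i1 < 2*h" "i0 \<noteq> i1" "card (hung i1) = 1"
    "i1 = Suc i0 mod (2*h) \<or> i0 = Suc i1 mod (2*h)"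
    using extremal_cycle_positions[OF laden cf] by blast
  obtain \<sigma> where \<sigma>: "bij_betw \<sigma> {..<2*h} {..<2*h}" "\<sigma> i0 = 0" "\<sigma> i1 = 1"
    "(\<forall>i<2*h. \<sigma> (Suc i mod (2*h)) = Suc (\<sigma> i) mod (2*h)) \<or> (\<forall>i<2*h. \<sigma> i = Suc (\<sigma> (Suc i mod (2*h))) mod (2*h))"
    using cycle_rotation[OF i(2,3,6)] h_ge_2 by auto
  obtain v where v: "hung i1 = {v}" using i(5) by (auto simp: card_1_singleton_iff)
  have vO: "v \<in> Off" "idx v = i1" using v by (auto simp: hung_def)
  have idx0: "idx x = i0" if "x \<in> Off" "x \<noteq> v" for x
  proof -
    have "x \<in> hung (idx x)" using that by (simp add: hung_def)
    then have "idx x \<in> laden" using idx_less[OF Off_Vs[OF that(1)]] by (auto simp: laden_def)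
    moreover have "idx x \<noteq> i1" using \<open>x \<in> hung (idx x)\<close> v that(2) by auto
    ultimately show ?thesis using i(1) by auto
  qed
  define child where "child = {x \<in> Off. par x \<in> Off}"
  define rest where "rest = Off - inner - child - {v}"
  have inner_sub: "inner \<subseteq> Off" by (auto simp: inner_def)
  have fin: "finite inner" "finite child" "finite rest"
    using finite_Off by (auto simp: inner_def child_def rest_def)
  have same: "x = y" if "x \<in> subtree z" "y \<in> subtree z" "x \<noteq> z" "y \<noteq> z" "z \<in> Off" for x y z
  proof (rule ccontr)
    assume "x \<noteq> y"
    then have "card {x, y, z} = 3" using that by simp
    moreover have "card {x, y, z} \<le> card (subtree z)"
      using that subtree_refl by (intro card_mono finite_subtree) auto
    ultimately show False using small that(5) by force
  qed
  have child_par: "x \<in> subtree (par x)" "x \<noteq> par x" "par x \<in> Off" "par x \<in> inner" "x \<in> Off" if "x \<in> child" for x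
    using that subtree_par(1)[of x] par_neq[of x] par_inner[of x] by (auto simp: child_def)
  \<comment> \<open>An inner child would have a vertex below it, which together with the child makes
    two vertices strictly below the parent.\<close>
  have child_inner: "child \<inter> inner = {}"
  proof (rule ccontr)
    assume "\<not> ?thesis"
    then obtain x where x: "x \<in> child" "x \<in> inner" by blast
    then have "subtree x \<noteq> {x}" by (auto simp: inner_def)
    then obtain y where y: "y \<in> subtree x" "y \<noteq> x"
      using subtree_refl[OF child_par(5)[OF x(1)]] by blast
    have "x \<in> Off" "par x \<in> Off" using child_par[OF x(1)] by auto
    from subtree_par[OF this] y have "y \<in> subtree (par x)" "y \<noteq> par x" by auto
    then show False using same[of y "par x" x] y(2) child_par[OF x(1)] by blast
  qed
  have inj_par: "inj_on par child"
  proof (rule inj_onI)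
    fix x y assume xy: "x \<in> child" "y \<in> child" "par x = par y"
    show "x = y"
      using same[of x "par x" y] child_par[OF xy(1)] child_par[OF xy(2)] xy(3) by simp
  qed
  have par_child: "par ` child = inner"
  proof (intro equalityI subsetI)
    fix z assume z: "z \<in> inner"
    then have "subtree z \<noteq> {z}" by (auto simp: inner_def)
    then obtain y where y: "y \<in> subtree z" "y \<noteq> z" using subtree_refl z inner_sub by blast
    then have "(y, z) \<in> up\<^sup>*" by (auto simp: subtree_def anc_def)
    with y(2) obtain w where "(w, z) \<in> up" by (meson rtranclE)
    then have "w \<in> child" "z = par w" using z inner_sub by (auto simp: up_iff child_def)
    then show "z \<in> par ` child" by blast
  qed (use child_par(4) in auto)
  have card_child: "card child = a" using card_image[OF inj_par] par_child inner by simp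
  \<comment> \<open>An off-cycle parent or child of \<open>v\<close> would hang at \<open>i1\<close>
    as well, where \<open>v\<close> is alone.\<close>
  have v_child: "v \<notin> child"
  proof
    assume vc: "v \<in> child"
    then have "par v \<in> hung i1" using child_par[OF vc] idx_par[OF vO(1)] vO(2) by (simp add: hung_def)
    then show False using v child_par(2)[OF vc] by simp
  qed
  have v_inner: "v \<notin> inner"
  proof
    assume "v \<in> inner"
    then obtain w where w: "w \<in> child" "v = par w" using par_child by auto
    then have "w \<in> hung i1" using idx_par[of w] child_par[OF w(1)] vO(2) by (simp add: hung_def)
    then show False using v w child_par(2)[OF w(1)] by auto
  qed
  have Off_eq: "Off = inner \<union> child \<union> rest \<union> {v}"
    using inner_sub vO child_par(5) by (auto simp: rest_def)
  have "card (inner \<union> child) = 2 * a"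
    using card_Un_disjoint[OF fin(2,1) child_inner] inner card_child by (simp add: Un_commute)
  moreover have "card (inner \<union> child \<union> rest) = card (inner \<union> child) + card rest"
    by (rule card_Un_disjoint) (use fin in \<open>auto simp: rest_def\<close>)
  moreover have "card Off = Suc (card (inner \<union> child \<union> rest))"
    by (subst Off_eq) (use fin v_inner v_child in \<open>simp add: rest_def\<close>)
  ultimately have card_rest: "card rest = b" using off by simp
  obtain \<phi> where \<phi>: "bij_betw \<phi> inner {1..a}"
    using finite_same_card_bij[OF fin(1), of "{1..a}"] inner by auto
  obtain \<psi> where \<psi>: "bij_betw \<psi> rest {a + 1..a + b}"
    using finite_same_card_bij[OF fin(3), of "{a + 1..a + b}"] card_rest by auto
  \<comment> \<open>A child takes the number of its parent, so that \<open>Pend i\<close> hangs at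
    \<open>Leaf i\<close>; inner vertices use the numbers up to \<open>a\<close>, the other leaves
    those after it.\<close>
  define f where "f x = (if x \<notin> Off then U (Suc (\<sigma> (idx x))) else if x = v then V
    else if x \<in> inner then Tr (Leaf (\<phi> x)) else if x \<in> child then Tr (Pend (\<phi> (par x)))
    else Tr (Leaf (\<psi> x)))" for x
  have f_u: "f (u j) = U (Suc (\<sigma> j))" if "j < 2*h" for j
    using that by (simp add: f_def u_notin_Off idx_u)
  have f_v: "f v = V" using vO by (simp add: f_def)
  have f_inner: "f x = Tr (Leaf (\<phi> x))" if "x \<in> inner" for x
    using that inner_sub v_inner by (auto simp: f_def)
  have f_child: "f x = Tr (Pend (\<phi> (par x)))" if "x \<in> child" for x
    using that child_par(5)[OF that] child_inner v_child by (auto simp: f_def)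
  have f_rest: "f x = Tr (Leaf (\<psi> x))" if "x \<in> rest" for x
    using that by (auto simp: f_def rest_def)
  have im_u: "f ` u ` {..<2*h} = (\<lambda>i. U (Suc i)) ` {..<2*h}"
  proof -
    have "f ` u ` {..<2*h} = (\<lambda>i. U (Suc i)) ` \<sigma> ` {..<2*h}"
      unfolding image_image by (rule image_cong) (auto simp: f_u)
    then show ?thesis using \<sigma>(1) by (simp add: bij_betw_def)
  qed
  have im_inner: "f ` inner = (\<lambda>i. Tr (Leaf i)) ` {1..a}"
  proof -
    have "f ` inner = (\<lambda>i. Tr (Leaf i)) ` \<phi> ` inner"
      unfolding image_image by (rule image_cong) (auto simp: f_inner)
    then show ?thesis using \<phi> by (simp add: bij_betw_def)
  qed
  have im_child: "f ` child = (\<lambda>i. Tr (Pend i)) ` {1..a}"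
  proof -
    have "f ` child = (\<lambda>i. Tr (Pend i)) ` \<phi> ` par ` child"
      unfolding image_image by (rule image_cong) (auto simp: f_child)
    then show ?thesis using \<phi> par_child by (simp add: bij_betw_def)
  qed
  have im_rest: "f ` rest = (\<lambda>i. Tr (Leaf i)) ` {a + 1..a + b}"
  proof -
    have "f ` rest = (\<lambda>i. Tr (Leaf i)) ` \<psi> ` rest"
      unfolding image_image by (rule image_cong) (auto simp: f_rest)
    then show ?thesis using \<psi> by (simp add: bij_betw_def)
  qed
  have im_Off: "f ` Off = S.Off"
  proof -
    have "f ` Off = (\<lambda>i. Tr (Leaf i)) ` ({1..a} \<union> {a + 1..a + b}) \<union> (\<lambda>i. Tr (Pend i)) ` {1..a} \<union> {V}"
      by (subst Off_eq) (simp only: image_Un im_inner im_child im_rest image_insert image_empty f_v, blast)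
    moreover have "{1..a} \<union> {a + 1..a + b} = {1..a + b}" by auto
    ultimately show ?thesis by (simp add: star_Off_eq[OF h_ge_2])
  qed
  have im: "f ` Vs = star_verts h a b"
    using arg_cong[OF Vs_split(1), of "image f"] S.Vs_split(1) unfolding image_Un im_u im_Off by simp
  \<comment> \<open>A surjection between finite sets of equal size is injective, which spares a
    comparison of the classes.\<close>
  have "card (f ` Vs) = card Vs"
    unfolding im S.card_Vs card_Vs off star_card_Off[OF h_ge_2] ..
  then have inj: "inj_on f Vs" by (rule eq_card_imp_inj_on[OF finite_Vs])
  have f_par: "f (par x) = star_par (f x)" if x: "x \<in> Off" for x
  proof -
    have to_cycle: "f (par x) = U (Suc (\<sigma> (idx x)))" if "x \<notin> child"
      using that x idx_par[OF x] by (simp add: f_def child_def)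
    consider "x = v" | "x \<in> inner" | "x \<in> child" | "x \<in> rest" using x Off_eq by blast
    then show ?thesis
    proof cases
      case 1
      then show ?thesis using to_cycle v_child f_v vO \<sigma>(3) by (simp add: numeral_2_eq_2)
    next
      case 2
      then have "x \<notin> child" "idx x = i0" using child_inner idx0[OF x] v_inner by auto
      then show ?thesis using 2 to_cycle \<sigma>(2) by (simp add: f_inner)
    next
      case 3
      then show ?thesis using child_par(4)[OF 3] by (simp add: f_child f_inner)
    next
      case 4
      then have "x \<notin> child" "idx x = i0" using idx0[OF x] by (auto simp: rest_def)
      then show ?thesis using 4 to_cycle \<sigma>(2) by (simp add: f_rest)
    qed
  qed
  have up: "map_prod f f ` up = S.up"
  proof -
    have "map_prod f f ` up = (\<lambda>x. (f x, f (par x))) ` Off"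
      by (auto simp: up_def image_iff)
    also have "\<dots> = (\<lambda>x. (f x, star_par (f x))) ` Off"
      by (rule image_cong) (auto simp: f_par)
    also have "\<dots> = (\<lambda>y. (y, star_par y)) ` f ` Off" by (simp add: image_image)
    finally show ?thesis unfolding im_Off by (auto simp: S.up_def)
  qed
  let ?C = "{(u i, u (Suc i mod (2*h))) | i. i < 2*h}"
  let ?D = "(\<lambda>j. (U (Suc j), U (Suc (Suc j mod (2*h))))) ` {..<2*h}"
  have imC: "map_prod f f ` ?C = (\<lambda>i. (U (Suc (\<sigma> i)), U (Suc (\<sigma> (Suc i mod (2*h)))))) ` {..<2*h}"
    using f_u next_u by (force simp: image_iff)
  \<comment> \<open>A reflection carries the oriented cycle to its converse, which has the same
    symmetric closure.\<close>
  have "map_prod f f ` ?C = ?D \<or> map_prod f f ` ?C = ?D\<inverse>"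
    using \<sigma>(4)
  proof
    assume s: "\<forall>i<2*h. \<sigma> (Suc i mod (2*h)) = Suc (\<sigma> i) mod (2*h)"
    have "map_prod f f ` ?C = (\<lambda>j. (U (Suc j), U (Suc (Suc j mod (2*h))))) ` \<sigma> ` {..<2*h}"
      unfolding imC image_image by (rule image_cong) (use s in auto)
    then show ?thesis using \<sigma>(1) by (simp add: bij_betw_def)
  next
    assume s: "\<forall>i<2*h. \<sigma> i = Suc (\<sigma> (Suc i mod (2*h))) mod (2*h)"
    have nx: "(\<lambda>i. Suc i mod (2*h)) ` {..<2*h} = {..<2*h}"
    proof (rule endo_inj_surj)
      show "inj_on (\<lambda>i. Suc i mod (2*h)) {..<2*h}"
      proof (rule inj_onI)
        fix i j assume "i \<in> {..<2*h}" "j \<in> {..<2*h}" "Suc i mod (2*h) = Suc j mod (2*h)"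
        then show "i = j" by (cases "Suc i = 2*h"; cases "Suc j = 2*h") auto
      qed
    qed (use h_ge_2 in auto)
    have "map_prod f f ` ?C =
      (\<lambda>j. (U (Suc (Suc j mod (2*h))), U (Suc j))) ` \<sigma> ` (\<lambda>i. Suc i mod (2*h)) ` {..<2*h}"
      unfolding imC image_image by (rule image_cong) (use s[rule_format, symmetric] in auto)
    also have "\<dots> = ?D\<inverse>"
      unfolding nx using \<sigma>(1) by (auto simp: bij_betw_def)
    finally show ?thesis ..
  qed
  then have C: "symcl (map_prod f f ` ?C) = symcl ?D" by (elim disjE) (simp_all only: symcl_converse)
  have "map_prod f f ` symcl base_arcs = symcl S.base_arcs"
    unfolding symcl_image[symmetric] base_arcs_def S.base_arcs_def image_Un up symcl_Un C
    by (rule arg_cong2[of _ _ _ _ "(\<union>)"]) (auto intro!: arg_cong[of _ _ symcl])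
  with inj im show ?thesis by (intro exI[of _ f]) simp
qed

end

lemma matching_number_attained:
  assumes "finite (edges G)"
  shows "\<exists>M. matching G M \<and> card M = matching_number G"
proof -
  have "finite {M. matching G M}"
    by (rule finite_subset[of _ "Pow (edges G)"]) (use assms in \<open>auto simp: matching_def\<close>)
  moreover have "{} \<in> {M. matching G M}" by (simp add: matching_def)
  ultimately have "matching_number G \<in> card ` {M. matching G M}"
    unfolding matching_number_def by (intro Max_in) auto
  then show ?thesis by auto
qed

theorem theorem3p7:
  fixes G :: "'a pair_pre_digraph" and n g \<beta> :: nat
  assumes "unicyclic G"
    and "card (pverts G) = n"
    and "unicyclic_girth G = g" and "even g"
    and "matching_number G = \<beta>"
    and "real \<beta> \<ge> 3 * real g / 2"
  shows "wiener G \<ge> wiener (G_star n g \<beta>)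
    \<and> real (wiener (G_star n g \<beta>)) =
        real n ^ 2 + (real \<beta> - 3 * real g / 2 - 1 + of_int \<lfloor>real g ^ 2 / 4\<rfloor>) * real n
        - real g / 2 * of_int \<lfloor>real g ^ 2 / 4\<rfloor> + 3 * real g / 2 - 3 * real \<beta> + 2
    \<and> (wiener G = wiener (G_star n g \<beta>)
        \<longleftrightarrow> digraph_iso (with_proj G) (with_proj (G_star n g \<beta>)))"
proof -
  obtain h where g: "g = 2 * h" using assms(4) by (auto elim: evenE)
  obtain u par dep where T: "cycle_with_trees (pverts G) h u par dep"
    and arcs: "parcs G = symcl (cycle_with_trees.base_arcs (pverts G) h u par)"
    using unicyclic_structure assms(1,3) g by blast
  interpret T: cycle_with_trees "pverts G" h u par dep by (rule T)
  have pg: "pair_graph G" using assms(1) by (simp add: unicyclic_def)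
  interpret G: pair_graph G by (rule pg)
  have "edges G = (\<lambda>(u, v). {u, v}) ` parcs G" by (auto simp: edges_def image_iff)
  then have "finite (edges G)" using G.pair_finite_arcs by simp
  then obtain M where M: "matching G M" "card M = \<beta>"
    using matching_number_attained assms(5) by blast
  then have M': "M \<subseteq> {{x, y} | x y. (x, y) \<in> symcl T.base_arcs}"
    "\<forall>e\<in>M. \<forall>f\<in>M. e \<noteq> f \<longrightarrow> e \<inter> f = {}"
    by (auto simp: matching_def edges_def arcs)
  have b1: "2 * \<beta> \<le> 2 * card T.inner + 2 * h + card T.laden" using T.matching_bound[OF M'] M(2) by simp
  have b2: "2 * \<beta> \<le> n" using T.matching_card_le[OF M'] M(2) assms(2) by simp
  have b3: "3 * h \<le> \<beta>" using assms(6) g by simp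
  have h2: "2 \<le> h" by (rule T.h_ge_2)
  \<comment> \<open>Both subtractions are exact, by \<open>b3\<close> and \<open>b2\<close>.\<close>
  define a b where "a = \<beta> - h - 1" and "b = n + 1 - 2 * \<beta>"
  let ?S = "G_star n g \<beta>"
  interpret S: cycle_with_trees "star_verts h a b" h "\<lambda>i. U (Suc i)" star_par star_dep
    by (rule star_cycle_with_trees[OF h2])
  have S: "pverts ?S = star_verts h a b" "parcs ?S = symcl S.base_arcs"
    using pverts_G_star[OF h2 a_def b_def] parcs_G_star[OF h2 a_def b_def] g by simp_all
  have a: "int a = int \<beta> - int h - 1" using b3 h2 by (simp add: a_def)
  have b: "int b = int n + 1 - 2 * int \<beta>" using b2 by (simp add: b_def)
  have n: "int n = 2 * int h + int (card T.Off)" using T.card_Vs assms(2) by simp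
  have off: "card T.Off = 2 * a + b + 1" using n a b by linarith
  have b2': "2 * \<beta> \<le> card (pverts G)" using b2 assms(2) by simp
  \<comment> \<open>The value of the star is brought literally into the shape of \<open>W\<close>,
    so that \<open>wiener_bound\<close> compares \<open>G\<close> with it.\<close>
  have wS: "int (wiener ?S) = (int n - 1) * (int (card T.Off) - (int \<beta> - int h - 1))
      + 2 * (int n - 2) * (int \<beta> - int h - 1) + int h ^ 3 + int h ^ 2 * int (card T.Off) + int (card T.Off) - 1"
    unfolding wiener_star[OF h2 S] off n a[symmetric] by (simp add: algebra_simps)
  note bound = T.wiener_bound[OF refl arcs b1 b2' b3, unfolded assms(2) wS[symmetric]]
  have le: "wiener ?S \<le> wiener G" using bound(1) by simp
  have wfG: "pair_wf_digraph G" by unfold_locales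
  have wfS: "pair_wf_digraph ?S" by (rule S.pair_wf[OF S])
  have eq: "wiener G = wiener ?S \<longleftrightarrow> digraph_iso (with_proj G) (with_proj ?S)"
  proof
    assume "wiener G = wiener ?S"
    with bound(2) have ext: "card T.laden = 2" "int (card T.inner) = int \<beta> - int h - 1"
      "\<forall>z\<in>T.Off. card (T.subtree z) \<le> 2" "int T.cyc_form = 2 * (int (card T.Off) - 1)" by simp_all
    have "card T.inner = a" using ext(2) a by simp
    from T.extremal_iso[OF ext(1,4) this ext(3) off]
    show "digraph_iso (with_proj G) (with_proj ?S)"
      unfolding digraph_iso_pair_iff[OF wfG] S arcs by blast
  qed (rule wiener_iso[OF wfG wfS])
  \<comment> \<open>As \<open>g\<close> is even, the quotient is already the integer
    \<open>h ^ 2\<close>.\<close>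
  have fl: "\<lfloor>real g ^ 2 / 4\<rfloor> = int h ^ 2"
  proof -
    have "real g ^ 2 / 4 = of_int (int h ^ 2)" by (simp add: g power_mult_distrib)
    then show ?thesis by (simp only: floor_of_int)
  qed
  have offr: "real (card T.Off) = real n - 2 * real h" using n by linarith
  have "real (wiener ?S) = real_of_int (int (wiener ?S))" by simp
  also have "\<dots> = (real n - 1) * (real (card T.Off) - (real \<beta> - real h - 1))
      + 2 * (real n - 2) * (real \<beta> - real h - 1) + real h ^ 3 + real h ^ 2 * real (card T.Off) + real (card T.Off) - 1"
    unfolding wS by simp
  also have "\<dots> = real n ^ 2 + (real \<beta> - 3 * real g / 2 - 1 + of_int \<lfloor>real g ^ 2 / 4\<rfloor>) * real n
        - real g / 2 * of_int \<lfloor>real g ^ 2 / 4\<rfloor> + 3 * real g / 2 - 3 * real \<beta> + 2"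
    unfolding offr fl g by (simp add: algebra_simps power2_eq_square power3_eq_cube)
  finally show ?thesis using le eq by blast
qed

end
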